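(* Let $m \neq \pm 1$ be a square-free rational integer, let $f(x) = x^{12} - m \in \mathbb{Z}[x]$, let $\alpha$ be a complex root of $f(x)$, and let $K = \mathbb{Q}(\alpha)$. If $m \equiv 1 \pmod 4$ or $m \equiv \pm 1 \pmod 9$, then $K$ is not monogenic, i.e. there is no $\theta \in \mathbb{Z}_K$ with $\mathbb{Z}_K = \mathbb{Z}[\theta]$.
   Context: $\mathbb{Z}_K$ denotes the ring of integers of $K$. A number field $K$ is monogenic if $\mathbb{Z}_K = \mathbb{Z}[\theta]$ for some $\theta \in \mathbb{Z}_K$, equivalently $\mathbb{Z}_K$ has a power integral basis $(1,\theta,\dots,\theta^{n-1})$. *)

theory Defs
  imports
    Complex_Main
    "HOL-Algebra.Algebraic_Closure_Type"
    "HOL-Algebra.Generated_Fields"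
    "HOL-Algebra.Generated_Rings"
    "HOL-Computational_Algebra.Computational_Algebra"
    "HOL-Number_Theory.Cong"
begin

text \<open>Number fields are taken as subfields of the complex numbers, represented by their
  underlying sets.\<close>

text \<open>The smallest subfield of the complex numbers containing \<open>\<alpha>\<close>; it contains the rationals
  because the characteristic is zero.\<close>

definition rat_adjoin :: "complex \<Rightarrow> complex set" where
  "rat_adjoin \<alpha> = generate_field ring_of_type_algebra {\<alpha>}"

definition int_adjoin :: "complex \<Rightarrow> complex set" where
  "int_adjoin \<theta> = generate_ring ring_of_type_algebra {\<theta>}"

definition ring_of_integers :: "complex set \<Rightarrow> complex set" where
  "ring_of_integers K = {x \<in> K. algebraic_int x}"

definition monogenic :: "complex set \<Rightarrow> bool" where
  "monogenic K \<longleftrightarrow> (\<exists>\<theta>\<in>ring_of_integers K. ring_of_integers K = int_adjoin \<theta>)"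

end

theory Submission
  imports Defs "Jordan_Normal_Form.Char_Poly"
begin

text \<open>Suppose the ring of integers \<open>A\<close> is \<open>\<int>[\<theta>]\<close>. Then \<open>A/pA\<close> is the quotient of a polynomial ring
  over the field with \<open>p\<close> elements by a polynomial of degree 12, so no nonzero polynomial of smaller degree
  kills \<open>\<theta>\<close> modulo \<open>p\<close>.

  Let \<open>\<tau> = \<alpha>\<^sup>3\<close> and \<open>c = \<plusminus>\<alpha>\<^sup>4\<close>. The cubic field of \<open>c\<close> is unramified at 2 and the quartic
  field of \<open>\<tau>\<close> is unramified at 3, so up to denominators prime to 2 (resp. 3) the ring \<open>A\<close> is
  generated by \<open>c\<close> and the integers of the quartic field (resp. by \<open>\<tau>\<close> and the integers of the cubic field).

  If \<open>m \<equiv> 1\<close> modulo 4, all residue fields of \<open>A\<close> at 2 are contained in the field with four elements and the nilpotents of \<open>A/2A\<close> square to zero, so \<open>x\<^sup>8 - x\<^sup>2 = (x\<^sup>4 - x)\<^sup>2 = 0\<close>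
  on \<open>A/2A\<close>, although 8 is less than 12.

  If \<open>m \<equiv> \<plusminus>1\<close> modulo 9, the cubic field has two primes above 3, separated by the square of
  \<open>\<gamma> = (1 + c + c\<^sup>2)/3\<close>. For \<open>m \<equiv> 1\<close> this gives four primes of \<open>K\<close> of degree one, but there
  are only three residues modulo 3. For \<open>m \<equiv> -1\<close> it gives four primes of degree two, but there are only
  three monic irreducible quadratics over the field with three elements.\<close>

hide_const (open) UnivPoly.coeff UnivPoly.monom Module.smult Divisibility.prime

subsection \<open>The ring of algebraic integers\<close>

text \<open>Neither an integral basis of \<open>A\<close> nor a prime ideal factorisation is
  computed. Divisibility by 2 or 3 means integrality of a quotient, tested in the ring of all
  complex algebraic integers, so conjugates may lie outside the field.

  The denominators come from partial traces: summing over the conjugates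
  \<open>z * \<alpha>\<close>, with \<open>z\<close> a third (resp. fourth) root of unity, isolates
  one coordinate. This leaves \<open>3 * M\<close>, prime to 2, or \<open>4 * m\<close>, prime to 3.

  The number of primes above 3 comes from \<open>x^4 - m\<close> modulo 3: for
  \<open>m \<equiv> 1\<close> it is \<open>(x - 1) * (x + 1) * (x^2 + 1)\<close>, for
  \<open>m \<equiv> -1\<close> a product of two quadratics; either way each of the two primes of the
  cubic field contributes two primes of the desired degree. The obstacle is that one of these two
  cubic primes is ramified, so Frobenius identities hold only modulo the ideal generated by 3 and
  \<open>c - 1\<close>. Its square lies in the ideal of 3, and idempotents carry conclusions back to
  divisibility by 3.\<close>

lemma eigenvalue_int_mat_algebraic_int:
  fixes x :: complex
  assumes A: "A \<in> carrier_mat n n" and ev: "eigenvalue (map_mat of_int A) x"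
  shows "algebraic_int x"
proof -
  have "poly (char_poly (map_mat of_int A)) x = 0"
    using ev A by (subst (asm) eigenvalue_root_char_poly[of _ n]) auto
  then have "poly (map_poly of_int (char_poly A)) x = 0"
    by (subst (asm) of_int_hom.char_poly_hom[OF A])
  moreover have "lead_coeff (char_poly A) = 1"
    using degree_monic_char_poly[OF A] by simp
  ultimately show ?thesis
    unfolding algebraic_int_altdef_ipoly by blast
qed

text \<open>An indexed family rather than a set: coincidences among the \<open>v i\<close>, such as
  equal products of powers, cost nothing.\<close>

definition int_span :: "'i set \<Rightarrow> ('i \<Rightarrow> complex) \<Rightarrow> complex set" where
  "int_span I v = {\<Sum>i\<in>I. of_int (r i) * v i |r. True}"

lemma int_span_zero: "0 \<in> int_span I v"
  unfolding int_span_def by (rule CollectI, rule exI[of _ "\<lambda>_. 0"]) auto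

lemma int_span_add: "a \<in> int_span I v \<Longrightarrow> b \<in> int_span I v \<Longrightarrow> a + b \<in> int_span I v"
  unfolding int_span_def
  by (clarsimp, rule_tac x = "\<lambda>i. r i + ra i" in exI) (simp add: sum.distrib algebra_simps)

lemma int_span_smult: "a \<in> int_span I v \<Longrightarrow> of_int z * a \<in> int_span I v"
  unfolding int_span_def
  by (clarsimp, rule_tac x = "\<lambda>i. z * r i" in exI) (simp add: sum_distrib_left mult.assoc)

lemma int_span_base: "finite I \<Longrightarrow> i \<in> I \<Longrightarrow> v i \<in> int_span I v"
  unfolding int_span_def
  by (rule CollectI, rule exI[of _ "\<lambda>j. if j = i then 1 else 0"]) (simp add: if_distrib if_distribR sum.delta cong: if_cong)

lemma int_span_sum: "(\<And>j. j \<in> J \<Longrightarrow> f j \<in> int_span I v) \<Longrightarrow> sum f J \<in> int_span I v"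
  by (induction J rule: infinite_finite_induct) (auto intro: int_span_add int_span_zero)

lemma int_span_mult_closed:
  assumes "\<And>i. i \<in> I \<Longrightarrow> x * v i \<in> int_span I v" and "a \<in> int_span I v"
  shows "x * a \<in> int_span I v"
proof -
  obtain r where a: "a = (\<Sum>i\<in>I. of_int (r i) * v i)"
    using assms(2) unfolding int_span_def by auto
  have "x * a = (\<Sum>i\<in>I. of_int (r i) * (x * v i))"
    unfolding a by (simp add: sum_distrib_left algebra_simps)
  then show ?thesis
    using assms(1) by (auto intro!: int_span_sum int_span_smult)
qed

text \<open>Writing each \<open>x * v i\<close> as an integer combination gives an integer matrix
  with \<open>v\<close> as eigenvector for \<open>x\<close>, and its characteristic polynomial is
  monic. The entry \<open>v i0\<close> makes the eigenvector nonzero.\<close>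

lemma algebraic_int_if_stable_span:
  fixes x :: complex
  assumes fin: "finite I" and nz: "i0 \<in> I" "v i0 \<noteq> 0"
    and stable: "\<And>i. i \<in> I \<Longrightarrow> x * v i \<in> int_span I v"
  shows "algebraic_int x"
proof -
  define n where "n = card I"
  obtain f where f: "bij_betw f {0..<n} I"
    using ex_bij_betw_nat_finite[OF fin] n_def by auto
  have "\<forall>i\<in>I. \<exists>r. x * v i = (\<Sum>j\<in>I. of_int (r j) * v j)"
    using stable unfolding int_span_def by fastforce
  then obtain r where r: "\<And>i. i \<in> I \<Longrightarrow> x * v i = (\<Sum>j\<in>I. of_int (r i j) * v j)"
    by metis
  define A where "A = Matrix.mat n n (\<lambda>(i, j). r (f i) (f j))"
  define u where "u = Matrix.vec n (\<lambda>i. v (f i))"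
  have A: "A \<in> carrier_mat n n" by (simp add: A_def)
  obtain k where k: "k < n" "f k = i0"
    using f nz(1) unfolding bij_betw_def by auto
  have u: "u \<in> carrier_vec n" by (simp add: u_def)
  have "u $ k \<noteq> 0" using k nz by (simp add: u_def)
  then have "u \<noteq> 0\<^sub>v n" using k by auto
  moreover have "map_mat of_int A *\<^sub>v u = x \<cdot>\<^sub>v u"
  proof (rule eq_vecI)
    fix i assume "i < dim_vec (x \<cdot>\<^sub>v u)"
    then have i: "i < n" by (simp add: u_def)
    then have fi: "f i \<in> I" using f unfolding bij_betw_def by auto
    have "(map_mat of_int A *\<^sub>v u) $ i = (\<Sum>j = 0..<n. of_int (r (f i) (f j)) * v (f j))"
      using i by (simp add: A_def u_def scalar_prod_def)
    also have "\<dots> = (\<Sum>j\<in>I. of_int (r (f i) j) * v j)"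
      by (rule sum.reindex_bij_betw[OF f])
    also have "\<dots> = (x \<cdot>\<^sub>v u) $ i"
      using r[OF fi] i by (simp add: u_def)
    finally show "(map_mat of_int A *\<^sub>v u) $ i = (x \<cdot>\<^sub>v u) $ i" .
  qed (simp add: A_def u_def)
  ultimately have "eigenvector (map_mat of_int A) u x"
    unfolding eigenvector_def using A u by auto
  then show ?thesis
    using eigenvalue_int_mat_algebraic_int[OF A] unfolding eigenvalue_def by blast
qed

lemma algebraic_int_power_reduction:
  fixes x :: complex
  assumes "algebraic_int x"
  obtains n r where "n > 0" "x ^ n = (\<Sum>i<n. of_int (r i) * x ^ i)"
proof -
  obtain p where p: "poly (map_poly of_int p) x = 0" "lead_coeff p = 1"
    using assms unfolding algebraic_int_altdef_ipoly by blast
  have d: "degree p > 0"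
  proof (rule ccontr)
    assume "\<not> degree p > 0"
    then obtain a where "p = [:a:]" by (auto elim: degree_eq_zeroE)
    then show False using p by simp
  qed
  have "0 = (\<Sum>i\<le>degree p. of_int (coeff p i) * x ^ i)"
    using p(1) by (simp add: poly_altdef coeff_map_poly degree_map_poly)
  also have "\<dots> = (\<Sum>i<degree p. of_int (coeff p i) * x ^ i) + x ^ degree p"
    using p(2) by (subst lessThan_Suc_atMost[symmetric]) simp
  finally have "x ^ degree p = - (\<Sum>i<degree p. of_int (coeff p i) * x ^ i)"
    by (metis add_eq_0_iff)
  then have "x ^ degree p = (\<Sum>i<degree p. of_int (- coeff p i) * x ^ i)"
    by (simp add: sum_negf)
  then show ?thesis by (rule that[OF d])
qed

text \<open>The products \<open>x ^ i * y ^ j\<close> with \<open>i < n\<close>,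
  \<open>j < k\<close> span a group stable under \<open>x\<close> and \<open>y\<close>, since the
  top powers are rewritten by the monic relations; stability passes to \<open>x + y\<close> and
  \<open>x * y\<close>. Positive \<open>n\<close> and \<open>k\<close> put the monomial 1 among
  them.\<close>

lemma algebraic_int_add_mult:
  fixes x y :: complex
  assumes "algebraic_int x" "algebraic_int y"
  shows "algebraic_int (x + y)" "algebraic_int (x * y)"
proof -
  obtain n r where n: "n > 0" "x ^ n = (\<Sum>i<n. of_int (r i) * x ^ i)"
    using algebraic_int_power_reduction[OF assms(1)] by blast
  obtain k s where k: "k > 0" "y ^ k = (\<Sum>i<k. of_int (s i) * y ^ i)"
    using algebraic_int_power_reduction[OF assms(2)] by blast
  define I where "I = {..<n} \<times> {..<k}"
  define v where "v = (\<lambda>(i, j). x ^ i * y ^ j)"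
  have fin: "finite I" by (simp add: I_def)
  have mon: "x ^ i * y ^ j \<in> int_span I v" if "i < n" "j < k" for i j
    using int_span_base[OF fin, of "(i, j)" v] that by (simp add: I_def v_def)
  have X: "x * v p \<in> int_span I v" if pI: "p \<in> I" for p
  proof -
    obtain i j where p: "p = (i, j)" "i < n" "j < k" using pI by (auto simp: I_def)
    show ?thesis
    proof (cases "Suc i < n")
      case True
      then show ?thesis using mon[of "Suc i" j] p by (simp add: v_def mult.assoc)
    next
      case False
      then have i: "Suc i = n" using p by simp
      have "x * v p = x ^ n * y ^ j" using p by (simp add: v_def flip: i)
      also have "\<dots> = (\<Sum>i<n. of_int (r i) * (x ^ i * y ^ j))"
        by (simp add: n sum_distrib_right mult.assoc)
      finally show ?thesis using mon p by (auto intro!: int_span_sum int_span_smult)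
    qed
  qed
  have Y: "y * v p \<in> int_span I v" if pI: "p \<in> I" for p
  proof -
    obtain i j where p: "p = (i, j)" "i < n" "j < k" using pI by (auto simp: I_def)
    show ?thesis
    proof (cases "Suc j < k")
      case True
      then show ?thesis using mon[of i "Suc j"] p by (simp add: v_def mult.left_commute)
    next
      case False
      then have j: "Suc j = k" using p by simp
      have "y * v p = x ^ i * y ^ k" using p by (simp add: v_def flip: j)
      also have "\<dots> = (\<Sum>j<k. of_int (s j) * (x ^ i * y ^ j))"
        by (simp add: k sum_distrib_left mult.left_commute)
      finally show ?thesis using mon p by (auto intro!: int_span_sum int_span_smult)
    qed
  qed
  have i0: "(0, 0) \<in> I" "v (0, 0) \<noteq> 0" using n k by (auto simp: I_def v_def)
  have "(x + y) * v p \<in> int_span I v" if "p \<in> I" for p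
    using int_span_add[OF X[OF that] Y[OF that]] by (simp add: distrib_right)
  then show "algebraic_int (x + y)"
    by (rule algebraic_int_if_stable_span[where v = v, OF fin i0])
  have "(x * y) * v p \<in> int_span I v" if "p \<in> I" for p
    using int_span_mult_closed[of I x v, OF X Y[OF that]] by (simp add: mult.assoc)
  then show "algebraic_int (x * y)"
    by (rule algebraic_int_if_stable_span[where v = v, OF fin i0])
qed

lemma algebraic_int_simps [simp, intro]:
  fixes x y :: complex
  shows "algebraic_int x \<Longrightarrow> algebraic_int y \<Longrightarrow> algebraic_int (x + y)"
    and "algebraic_int x \<Longrightarrow> algebraic_int y \<Longrightarrow> algebraic_int (x - y)"
    and "algebraic_int x \<Longrightarrow> algebraic_int y \<Longrightarrow> algebraic_int (x * y)"
    and "algebraic_int x \<Longrightarrow> algebraic_int (x ^ n)"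
    and "algebraic_int (of_int z :: complex)"
    and "algebraic_int (1 :: complex)"
    and "algebraic_int (numeral k :: complex)"
    and "algebraic_int (of_nat j :: complex)"
proof -
  show "algebraic_int x \<Longrightarrow> algebraic_int y \<Longrightarrow> algebraic_int (x + y)"
    and "algebraic_int x \<Longrightarrow> algebraic_int y \<Longrightarrow> algebraic_int (x * y)"
    by (simp_all add: algebraic_int_add_mult)
  show "algebraic_int x \<Longrightarrow> algebraic_int y \<Longrightarrow> algebraic_int (x - y)"
    using algebraic_int_add_mult(1)[of x "- y"] by simp
  show "algebraic_int x \<Longrightarrow> algebraic_int (x ^ n)"
    by (induction n) (auto simp: algebraic_int_add_mult int_imp_algebraic_int)
qed (auto intro: int_imp_algebraic_int)

lemma algebraic_int_sum:
  fixes f :: "'i \<Rightarrow> complex"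
  shows "(\<And>i. i \<in> I \<Longrightarrow> algebraic_int (f i)) \<Longrightarrow> algebraic_int (sum f I)"
  by (induction I rule: infinite_finite_induct) auto

lemma algebraic_int_poly:
  fixes x :: complex
  shows "algebraic_int x \<Longrightarrow> algebraic_int (poly (map_poly of_int P) x)"
  by (induction P) (auto simp: map_poly_pCons)

lemma algebraic_int_of_rat:
  assumes "algebraic_int (of_rat q :: complex)"
  obtains z where "q = of_int z"
proof -
  have "(of_rat q :: complex) \<in> \<int>"
    using rational_algebraic_int_is_int[OF assms] by simp
  then obtain z where "(of_rat q :: complex) = of_int z" by (auto elim: Ints_cases)
  then have "of_rat q = (of_rat (of_int z) :: complex)" by simp
  then show ?thesis using that by (simp only: of_rat_eq_iff)
qed

lemma algebraic_int_of_int_divide_dvd: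
  assumes "algebraic_int (of_int a / of_int b :: complex)" "b \<noteq> 0"
  shows "b dvd a"
proof -
  obtain z where z: "(of_int a / of_int b :: rat) = of_int z"
    using algebraic_int_of_rat[of "of_int a / of_int b"] assms(1) by (auto simp: of_rat_divide)
  then have "(of_int a :: rat) = of_int (b * z)" using assms(2) by (simp add: field_simps)
  then show ?thesis by (simp only: of_int_eq_iff) simp
qed

subsection \<open>The field generated by a twelfth root\<close>

abbreviation rpoly :: "rat poly \<Rightarrow> complex \<Rightarrow> complex" where
  "rpoly P x \<equiv> poly (map_poly of_rat P) x"

abbreviation ipoly :: "int poly \<Rightarrow> complex \<Rightarrow> complex" where
  "ipoly P x \<equiv> poly (map_poly of_int P) x"

lemma degree_monom_diff_const:
  fixes a :: "'a :: comm_ring_1"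
  assumes "n > 0"
  shows "degree (Polynomial.monom 1 n - [:a:]) = n"
proof -
  have "degree (Polynomial.monom 1 n + [:- a:]) = n"
    using assms by (subst degree_add_eq_left) (auto simp: degree_monom_eq)
  then show ?thesis by (simp add: diff_conv_add_uminus del: add_uminus_conv_diff)
qed

lemma common_denominator:
  fixes a :: "'i \<Rightarrow> rat"
  assumes "finite I"
  shows "\<exists>d::int. d > 0 \<and> (\<forall>i\<in>I. \<exists>z. of_int d * a i = of_int z)"
  using assms
proof (induction I rule: finite_induct)
  case empty
  then show ?case by (auto intro: exI[of _ 1])
next
  case (insert j I)
  then obtain d where d: "d > 0" "\<And>i. i \<in> I \<Longrightarrow> \<exists>z. of_int d * a i = of_int z" by blast
  obtain n k where q: "a j = of_int n / of_int k" "k > 0"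
    by (metis quotient_of_denom_pos quotient_of_div surj_pair)
  have "\<exists>z. of_int (d * k) * a i = of_int z" if i: "i \<in> insert j I" for i
  proof (cases "i = j")
    case True
    then have "of_int (d * k) * a i = of_int (d * n)" using q by simp
    then show ?thesis by blast
  next
    case False
    then obtain z where "of_int d * a i = of_int z" using d i by blast
    then have "of_int (d * k) * a i = of_int (k * z)" by (simp add: mult_ac)
    then show ?thesis by blast
  qed
  moreover have "d * k > 0" using d q by simp
  ultimately show ?case by blast
qed

lemma ipoly_eq_sum:
  assumes "degree P < n"
  shows "ipoly P x = (\<Sum>i<n. of_int (coeff P i) * x ^ i)"
proof -
  have "ipoly P x = (\<Sum>i\<le>degree P. of_int (coeff P i) * x ^ i)"
    by (simp add: poly_altdef coeff_map_poly degree_map_poly)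
  also have "\<dots> = (\<Sum>i<n. of_int (coeff P i) * x ^ i)"
    using assms by (intro sum.mono_neutral_left) (auto simp: coeff_eq_0)
  finally show ?thesis .
qed

lemma rpoly_eq_sum:
  assumes "degree P < n"
  shows "rpoly P x = (\<Sum>i<n. of_rat (coeff P i) * x ^ i)"
proof -
  have "rpoly P x = (\<Sum>i\<le>degree P. of_rat (coeff P i) * x ^ i)"
    by (simp add: poly_altdef coeff_map_poly degree_map_poly)
  also have "\<dots> = (\<Sum>i<n. of_rat (coeff P i) * x ^ i)"
    using assms by (intro sum.mono_neutral_left) (auto simp: coeff_eq_0)
  finally show ?thesis .
qed

interpretation of_rat_poly_hom: map_poly_idom_hom of_rat ..

lemma rpoly_simps [simp]:
  "rpoly (P + Q) x = rpoly P x + rpoly Q x"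
  "rpoly (P - Q) x = rpoly P x - rpoly Q x"
  "rpoly (- P) x = - rpoly P x"
  "rpoly (P * Q) x = rpoly P x * rpoly Q x"
  "rpoly (smult q P) x = of_rat q * rpoly P x"
  "rpoly (pcompose P Q) x = rpoly P (rpoly Q x)"
  "rpoly (map_poly of_int R) x = ipoly R x"
  by (simp_all add: of_rat_hom.map_poly_pcompose of_rat_hom.map_poly_hom_smult poly_pcompose map_poly_map_poly o_def hom_distribs)

lemma ipoly_simps [simp]:
  "ipoly (P + Q) x = ipoly P x + ipoly Q x"
  "ipoly (P - Q) x = ipoly P x - ipoly Q x"
  "ipoly (P * Q) x = ipoly P x * ipoly Q x"
  "ipoly (- P) x = - ipoly P x"
  "ipoly (smult q P) x = of_int q * ipoly P x"
  by (simp_all add: hom_distribs)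

locale pure12 =
  fixes m :: int and \<alpha> :: complex
  assumes sqf: "squarefree m" and m_neq: "m \<noteq> 1" "m \<noteq> - 1" and root: "\<alpha> ^ 12 = of_int m"
begin

lemma m_nonzero: "m \<noteq> 0"
  using sqf by auto

lemma alpha_integral [simp]: "algebraic_int \<alpha>"
proof -
  have "poly (map_poly of_int (Polynomial.monom 1 12 - [:m:])) \<alpha> = 0"
    using root by (simp add: hom_distribs poly_monom)
  moreover have "lead_coeff (Polynomial.monom 1 12 - [:m:]) = 1"
  proof -
    show ?thesis by (simp add: degree_monom_diff_const coeff_diff coeff_pCons)
  qed
  ultimately show ?thesis unfolding algebraic_int_altdef_ipoly by blast
qed

text \<open>Supplies the Eisenstein prime of \<open>x^12 - m\<close>: a prime factor exists because
  \<open>m\<close> is not a unit, and it is simple because \<open>m\<close> is squarefree.\<close>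

lemma prime_exactly_dividing: obtains p m' where "prime p" "m = p * m'" "\<not> p dvd m'"
proof -
  have "\<not> is_unit m" using m_neq by (auto simp: zdvd1_eq)
  then obtain p where p: "prime p" "p dvd m"
    using m_nonzero prime_divisor_exists by blast
  then obtain m' where m': "m = p * m'" by blast
  have "\<not> p dvd m'"
  proof
    assume "p dvd m'"
    then have "p ^ 2 dvd m" using m' by (simp add: power2_eq_square)
    then have "is_unit p" using sqf unfolding squarefree_def by blast
    then show False using p by (simp add: not_prime_unit)
  qed
  then show ?thesis using that p m' by blast
qed

text \<open>Eisenstein's argument: at the first coefficient not divisible by \<open>p\<close>, multiplying the
  relation by a power of \<open>\<alpha>\<close> shows that \<open>a\<^sub>i * \<alpha> ^ 11 / p\<close> is integral, and so is its twelfth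
  power.\<close>

lemma int_poly_independent:
  assumes deg: "degree P < 12" and zero: "ipoly P \<alpha> = 0"
  shows "P = 0"
proof (rule ccontr)
  assume P: "P \<noteq> 0"
  obtain p m' where p: "prime p" "m = p * m'" "\<not> p dvd m'" by (rule prime_exactly_dividing)
  define Q where "Q = primitive_part P"
  have "ipoly P \<alpha> = of_int (content P) * ipoly Q \<alpha>"
    by (subst content_times_primitive_part[of P, symmetric]) (simp only: ipoly_simps Q_def)
  then have Q0: "ipoly Q \<alpha> = 0" using zero P by simp
  have degQ: "degree Q < 12" using deg by (simp add: Q_def)
  have p0: "(of_int p :: complex) \<noteq> 0" using p by auto
  have "p dvd coeff Q i" if "i < 12" for i
    using that
  proof (induction i rule: less_induct)
    case (less i)
    \<comment> \<open>The shift gives the \<open>i\<close>-th term the factor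
      \<open>\<alpha> ^ 11\<close>. Earlier terms lose their denominator by induction, later ones
      contain \<open>\<alpha> ^ 12 = p * m'\<close>.\<close>
    define t where "t = (\<lambda>j. of_int (coeff Q j) * \<alpha> ^ (j + 11 - i) / of_int p)"
    have "(\<Sum>j<12. t j) = ipoly Q \<alpha> * \<alpha> ^ (11 - i) / of_int p"
      unfolding ipoly_eq_sum[OF degQ] t_def sum_distrib_right sum_divide_distrib
      using less.prems by (intro sum.cong) (auto simp: mult.assoc simp flip: power_add)
    then have "t i = - (\<Sum>j\<in>{..<12} - {i}. t j)"
      using Q0 less.prems by (simp add: sum.remove[of _ i] add_eq_0_iff)
    moreover have "algebraic_int (t j)" if j: "j \<in> {..<12} - {i}" for j
    proof (cases "j < i")
      case True
      then obtain q where "coeff Q j = p * q" using less.IH less.prems by fastforce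
      then have "t j = of_int q * \<alpha> ^ (j + 11 - i)" using p0 by (simp add: t_def)
      then show ?thesis by simp
    next
      case False
      then have "\<alpha> ^ (j + 11 - i) = \<alpha> ^ 12 * \<alpha> ^ (j - i - 1)"
        using j less.prems by (subst power_add[symmetric]) (auto intro!: arg_cong[of _ _ "power \<alpha>"])
      then have "t j = of_int (coeff Q j * m') * \<alpha> ^ (j - i - 1)"
        using p0 p(2) root by (simp add: t_def)
      then show ?thesis by (simp only: algebraic_int_simps alpha_integral)
    qed
    ultimately have "algebraic_int (t i)" using algebraic_int_sum[of "{..<12} - {i}" t] by simp
    then have "algebraic_int (t i ^ 12)" by simp
    moreover have "t i ^ 12 = of_int (coeff Q i ^ 12 * m ^ 11) / of_int (p ^ 12)"
    proof -
      have "(\<alpha> ^ 11) ^ 12 = of_int m ^ 11" by (simp flip: power_mult root)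
      then show ?thesis by (simp add: t_def power_mult_distrib power_divide)
    qed
    \<comment> \<open>\<open>m ^ 11\<close> contains \<open>p\<close> only 11 times against 12 in
      the denominator, so one factor \<open>p\<close> is left for the coefficient.\<close>
    ultimately have "p ^ 12 dvd coeff Q i ^ 12 * m ^ 11"
      using algebraic_int_of_int_divide_dvd p(1) by (metis not_prime_0 power_not_zero)
    then have "p ^ 11 * p dvd p ^ 11 * (coeff Q i ^ 12 * m' ^ 11)"
      using p(2) by (simp add: power_mult_distrib mult_ac flip: power_Suc)
    then have "p dvd coeff Q i ^ 12 * m' ^ 11"
      using p(1) by (subst (asm) dvd_mult_cancel_left) auto
    then show ?case using p by (metis prime_dvd_mult_iff prime_dvd_power)
  qed
  then have "p dvd coeff Q i" for i
    using degQ by (cases "i < 12") (auto simp: coeff_eq_0)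
  then have "p dvd content Q" by (simp add: const_poly_dvd_iff_dvd_content[symmetric] const_poly_dvd_iff)
  then have "is_unit p" using P by (simp add: Q_def)
  then show False using p by (simp add: not_prime_unit)
qed

lemma rat_sum_independent:
  fixes a :: "nat \<Rightarrow> rat"
  assumes "(\<Sum>i<12. of_rat (a i) * \<alpha> ^ i) = 0" and "i < 12"
  shows "a i = 0"
proof -
  obtain d where d: "d > 0" "\<forall>i\<in>{..<12}. \<exists>z. of_int d * a i = of_int z"
    using common_denominator[of "{..<12}" a] by auto
  then obtain z where z: "\<And>i. i < 12 \<Longrightarrow> of_int d * a i = of_int (z i)"
    by (metis lessThan_iff)
  define P where "P = (\<Sum>i<12. Polynomial.monom (z i) i)"
  have coeff: "coeff P i = (if i < 12 then z i else 0)" for i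
    by (simp add: P_def coeff_sum if_distrib cong: if_cong)
  have "degree P \<le> 11" by (rule degree_le) (simp add: coeff)
  then have degP: "degree P < 12" by simp
  have "of_int (z i) = (of_int d * of_rat (a i) :: complex)" if "i < 12" for i
    using z[OF that] by (metis of_rat_mult of_rat_of_int_eq)
  then have "ipoly P \<alpha> = (\<Sum>i<12. of_int d * (of_rat (a i) * \<alpha> ^ i))"
    by (simp add: ipoly_eq_sum[OF degP] coeff mult.assoc)
  also have "\<dots> = of_int d * (\<Sum>i<12. of_rat (a i) * \<alpha> ^ i)"
    by (simp only: sum_distrib_left)
  also have "\<dots> = 0" using assms(1) by simp
  finally have "P = 0" by (rule int_poly_independent[OF degP])
  then have "z i = 0" using coeff[of i] assms(2) by simp
  then show ?thesis using z[OF assms(2)] d by simp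
qed

lemma rat_poly_independent:
  assumes deg: "degree P < 12" and "rpoly P \<alpha> = 0"
  shows "P = 0"
proof (rule poly_eqI)
  fix i show "coeff P i = coeff 0 i"
    using rat_sum_independent[of "coeff P" i] assms rpoly_eq_sum[OF deg, of \<alpha>]
    by (cases "i < 12") (auto simp: coeff_eq_0)
qed

definition minpol :: "rat poly" where
  "minpol = Polynomial.monom 1 12 - [:of_int m:]"

lemma rpoly_minpol: "rpoly minpol x = x ^ 12 - of_int m"
  by (simp add: minpol_def hom_distribs poly_monom)

lemma degree_minpol: "degree minpol = 12"
  by (simp add: minpol_def degree_monom_diff_const)

lemma degree_mod_minpol: "degree (P mod minpol) < 12"
  using degree_mod_less[of minpol P] degree_minpol by (cases "minpol = 0") auto

lemma minpol_dvd:
  assumes "rpoly P \<alpha> = 0"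
  shows "minpol dvd P"
proof -
  have "rpoly (minpol * (P div minpol) + P mod minpol) \<alpha> = 0" using assms by simp
  then have "rpoly (P mod minpol) \<alpha> = 0"
    by (simp only: rpoly_simps rpoly_minpol root) simp
  moreover have "degree (P mod minpol) < 12"
    by (rule degree_mod_minpol)
  ultimately have "P mod minpol = 0" using rat_poly_independent by blast
  then show ?thesis by (simp add: mod_eq_0_iff_dvd)
qed

text \<open>The monic \<open>q\<close> composed with \<open>P\<close> vanishes at
  \<open>\<alpha>\<close>, hence is a multiple of \<open>minpol\<close>, which also vanishes at
  \<open>z * \<alpha>\<close>. This replaces field embeddings.\<close>

lemma algebraic_int_conjugate:
  assumes int: "algebraic_int (rpoly P \<alpha>)" and z: "z ^ 12 = 1"
  shows "algebraic_int (rpoly P (z * \<alpha>))"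
proof -
  obtain q where q: "ipoly q (rpoly P \<alpha>) = 0" "lead_coeff q = 1"
    using int unfolding algebraic_int_altdef_ipoly by blast
  have "rpoly (pcompose (map_poly of_int q) P) \<alpha> = 0"
    by (simp only: rpoly_simps q)
  then obtain R where R: "pcompose (map_poly of_int q) P = minpol * R"
    using minpol_dvd by (metis dvdE)
  have "ipoly q (rpoly P (z * \<alpha>)) = rpoly (pcompose (map_poly of_int q) P) (z * \<alpha>)"
    by (simp only: rpoly_simps)
  also have "\<dots> = 0" 
    unfolding R by (simp add: rpoly_minpol power_mult_distrib z root del: of_rat_hom.hom_mult)
  finally show ?thesis using q(2) unfolding algebraic_int_altdef_ipoly by blast
qed

text \<open>Dividing \<open>minpol\<close> by \<open>P\<close> gives
  \<open>P(\<alpha>) * q(\<alpha>) = - r(\<alpha>)\<close>, which reduces the inverse of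
  \<open>P(\<alpha>)\<close> to that of a remainder of smaller degree. The remainder is nonzero, as
  otherwise \<open>q\<close> would annihilate \<open>\<alpha>\<close> in degree below 12.\<close>

lemma rpoly_inverse:
  assumes "P \<noteq> 0" "degree P < 12"
  shows "\<exists>Q. inverse (rpoly P \<alpha>) = rpoly Q \<alpha>"
  using assms
proof (induction "degree P" arbitrary: P rule: less_induct)
  case less
  show ?case
  proof (cases "degree P = 0")
    case True
    then obtain c where "P = [:c:]" by (auto elim: degree_eq_zeroE)
    then have "inverse (rpoly P \<alpha>) = rpoly [:inverse c:] \<alpha>" by (simp add: hom_distribs of_rat_inverse)
    then show ?thesis by blast
  next
    case False
    define q r where "q = minpol div P" and "r = minpol mod P"
    have qr: "minpol = P * q + r" by (simp add: q_def r_def)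
    have degr: "degree r < degree P"
      using False degree_mod_less[OF less.prems(1), of minpol] by (auto simp: r_def)
    have P0: "rpoly P \<alpha> \<noteq> 0" using rat_poly_independent less.prems by blast
    have "rpoly minpol \<alpha> = 0" by (simp add: rpoly_minpol root)
    then have eq: "rpoly P \<alpha> * rpoly q \<alpha> = - rpoly r \<alpha>"
      unfolding qr rpoly_simps by (rule eq_neg_iff_add_eq_0[THEN iffD2])
    have "r \<noteq> 0"
    proof
      assume r: "r = 0"
      then have mq: "minpol = P * q" using qr by simp
      then have q0: "q \<noteq> 0" using degree_minpol by auto
      have "degree q < 12"
        using degree_minpol False less.prems(1) q0 unfolding mq by (simp add: degree_mult_eq)
      moreover have "rpoly q \<alpha> = 0" using eq r P0 by simp
      ultimately show False using rat_poly_independent q0 by blast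
    qed
    then obtain Q where Q: "inverse (rpoly r \<alpha>) = rpoly Q \<alpha>"
      using less.hyps[OF degr] degr less.prems by fastforce
    have r0: "rpoly r \<alpha> \<noteq> 0"
      using rat_poly_independent \<open>r \<noteq> 0\<close> degr less.prems by fastforce
    have "inverse (rpoly P \<alpha>) = - rpoly q \<alpha> * rpoly Q \<alpha>"
      unfolding Q[symmetric] using eq r0 P0 by (simp add: field_simps)
    then have "inverse (rpoly P \<alpha>) = rpoly (- q * Q) \<alpha>" by (simp only: rpoly_simps)
    then show ?thesis by blast
  qed
qed

lemma rat_adjoin_eq: "rat_adjoin \<alpha> = range (\<lambda>P. rpoly P \<alpha>)"
proof -
  interpret R: field "ring_of_type_algebra :: complex ring" by (rule field_from_type_algebra)
  let ?R = "ring_of_type_algebra :: complex ring"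
  have ops: "x \<oplus>\<^bsub>?R\<^esub> y = x + y" "x \<otimes>\<^bsub>?R\<^esub> y = x * y" "\<one>\<^bsub>?R\<^esub> = 1" "\<zero>\<^bsub>?R\<^esub> = 0" "x \<in> carrier ?R" for x y
    by (simp_all add: ring_of_type_algebra_def)
  have neg: "\<ominus>\<^bsub>?R\<^esub> x = - x" for x
    using R.minus_equality[of "- x" x] by (simp add: ops)
  have inv: "inv\<^bsub>?R\<^esub> x = inverse x" if "x \<noteq> 0" for x
    using R.inv_unique'[of x "inverse x"] that by (simp add: ops)
  show ?thesis
  proof (intro equalityI subsetI)
    fix x assume "x \<in> rat_adjoin \<alpha>"
    then have "x \<in> generate_field ?R {\<alpha>}" by (simp add: rat_adjoin_def)
    then show "x \<in> range (\<lambda>P. rpoly P \<alpha>)"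
    proof (induction rule: generate_field.induct)
      case one
      then show ?case by (auto simp: ops intro!: range_eqI[of _ _ 1])
    next
      case (incl h)
      then show ?case by (auto intro!: range_eqI[of _ _ "[:0, 1:]"] simp: hom_distribs)
    next
      case (a_inv h)
      then obtain P where "h = rpoly P \<alpha>" by auto
      then have "\<ominus>\<^bsub>?R\<^esub> h = rpoly (- P) \<alpha>" by (simp add: neg)
      then show ?case by blast
    next
      case (m_inv h)
      then obtain P where P: "h = rpoly P \<alpha>" by auto
      define r where "r = P mod minpol"
      have "rpoly P \<alpha> = rpoly (minpol * (P div minpol) + P mod minpol) \<alpha>" by simp
      also have "\<dots> = rpoly r \<alpha>" by (simp only: rpoly_simps rpoly_minpol root r_def) simp
      finally have hr: "h = rpoly r \<alpha>" by (simp add: P)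
      moreover have "degree r < 12"
        by (simp add: r_def degree_mod_minpol)
      moreover have "h \<noteq> 0" using m_inv by (simp add: ops)
      moreover have "r \<noteq> 0" using \<open>h \<noteq> 0\<close> hr by auto
      ultimately obtain Q where "inverse h = rpoly Q \<alpha>" using rpoly_inverse[of r] by auto
      then have "inv\<^bsub>?R\<^esub> h = rpoly Q \<alpha>" using inv \<open>h \<noteq> 0\<close> by simp
      then show ?case by blast
    next
      case (eng_add h1 h2)
      then obtain P Q where "h1 = rpoly P \<alpha>" "h2 = rpoly Q \<alpha>" by auto
      then have "h1 \<oplus>\<^bsub>?R\<^esub> h2 = rpoly (P + Q) \<alpha>" by (simp add: ops)
      then show ?case by blast
    next
      case (eng_mult h1 h2)
      then obtain P Q where "h1 = rpoly P \<alpha>" "h2 = rpoly Q \<alpha>" by auto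
      then have "h1 \<otimes>\<^bsub>?R\<^esub> h2 = rpoly (P * Q) \<alpha>" by (simp add: ops)
      then show ?case by blast
    qed
  next
    fix x assume "x \<in> range (\<lambda>P. rpoly P \<alpha>)"
    then obtain P where x: "x = rpoly P \<alpha>" by auto
    have sub: "subfield (rat_adjoin \<alpha>) ?R"
      unfolding rat_adjoin_def by (rule R.generate_field_is_subfield) (simp add: ops)
    have one: "1 \<in> rat_adjoin \<alpha>" unfolding rat_adjoin_def using generate_field.one[of ?R] by (simp add: ops)
    have al: "\<alpha> \<in> rat_adjoin \<alpha>" unfolding rat_adjoin_def by (rule generate_field.incl) simp
    have add: "a + b \<in> rat_adjoin \<alpha>" if "a \<in> rat_adjoin \<alpha>" "b \<in> rat_adjoin \<alpha>" for a b
      using generate_field.eng_add[of a ?R _ b] that unfolding rat_adjoin_def by (simp add: ops)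
    have mul: "a * b \<in> rat_adjoin \<alpha>" if "a \<in> rat_adjoin \<alpha>" "b \<in> rat_adjoin \<alpha>" for a b
      using generate_field.eng_mult[of a ?R _ b] that unfolding rat_adjoin_def by (simp add: ops)
    have minus: "- a \<in> rat_adjoin \<alpha>" if "a \<in> rat_adjoin \<alpha>" for a
      using generate_field.a_inv[of a ?R] that unfolding rat_adjoin_def by (simp add: neg)
    have inverse: "inverse a \<in> rat_adjoin \<alpha>" if "a \<in> rat_adjoin \<alpha>" for a
      using generate_field.m_inv[of a ?R] that inv[of a] unfolding rat_adjoin_def by (cases "a = 0") (auto simp: ops)
    have zero: "0 \<in> rat_adjoin \<alpha>" using add[OF one minus[OF one]] by simp
    have nat: "of_nat n \<in> rat_adjoin \<alpha>" for n
      by (induction n) (auto simp: zero one add)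
    have int: "of_int z \<in> rat_adjoin \<alpha>" for z
      by (cases z rule: int_cases2) (auto simp: nat minus)
    have rat: "of_rat q \<in> rat_adjoin \<alpha>" for q
    proof -
      obtain a b where "q = of_int a / of_int b"
        by (metis quotient_of_div surj_pair)
      then have "of_rat q = (of_int a / of_int b :: complex)"
        by (simp only: of_rat_divide of_rat_of_int_eq)
      then have "of_rat q = of_int a * inverse (of_int b :: complex)"
        by (simp only: divide_inverse)
      then show ?thesis using mul int inverse by simp
    qed
    show "x \<in> rat_adjoin \<alpha>"
      unfolding x by (induction P) (auto simp: map_poly_pCons zero intro!: add mul rat al)
  qed
qed

end

subsection \<open>The quartic and cubic subfields\<close>

lemma rpoly_pCons [simp]: "rpoly (pCons a P) x = of_rat a + x * rpoly P x"
  by (simp add: hom_distribs)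

lemma rpoly_monom [simp]: "rpoly (Polynomial.monom a n) x = of_rat a * x ^ n"
  by (simp add: hom_distribs poly_monom)

declare poly_monom [simp]

text \<open>The sign \<open>\<epsilon>\<close> is there so that \<open>m \<equiv> \<plusminus>1\<close> modulo 9 both become \<open>M \<equiv> 1\<close>, where
  \<open>M = c\<^sup>3\<close>.\<close>

locale pure12_tower = pure12 +
  fixes \<epsilon> :: int and M :: int and c \<tau> s :: complex
  assumes eps: "\<epsilon> = 1 \<or> \<epsilon> = - 1"
  defines "M \<equiv> \<epsilon> * m"
    and "c \<equiv> of_int \<epsilon> * \<alpha> ^ 4"
    and "\<tau> \<equiv> \<alpha> ^ 3"
    and "s \<equiv> \<alpha> ^ 6"
begin

lemma eps_square [simp]: "\<epsilon> ^ 2 = 1" "(of_int \<epsilon> :: complex) * of_int \<epsilon> = 1" "(of_int \<epsilon> :: complex) ^ 2 = 1"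
  using eps by auto

lemma M_nonzero: "M \<noteq> 0"
  using m_nonzero eps by (auto simp: M_def)

lemma c_cube: "c ^ 3 = of_int M"
proof -
  have "(of_int \<epsilon> :: complex) ^ 3 = of_int \<epsilon>" using eps by auto
  then show ?thesis using root by (simp add: c_def M_def power_mult_distrib flip: power_mult)
qed

lemma tau_square: "\<tau> ^ 2 = s" and s_square: "s ^ 2 = of_int m" and tau_four: "\<tau> ^ 4 = of_int m"
  using root by (simp_all add: \<tau>_def s_def flip: power_mult)

text \<open>The exponents \<open>9 + 4 = 13\<close> wrap around to 1. So \<open>\<alpha>\<close> is
  recovered from \<open>\<tau>\<close> and \<open>c\<close>, and the field is the compositum of the
  quartic and the cubic one.\<close>

lemma tau_c_alpha: "\<tau> ^ 3 * c = of_int M * \<alpha>"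
proof -
  have "\<tau> ^ 3 * c = of_int \<epsilon> * (\<alpha> ^ 12 * \<alpha>)"
    by (simp add: \<tau>_def c_def flip: power_mult power_add power_Suc2)
  then show ?thesis by (simp add: root M_def)
qed

lemma integral_gens [simp]: "algebraic_int c" "algebraic_int \<tau>" "algebraic_int s"
  by (simp_all add: c_def \<tau>_def s_def)

definition K where "K = range (\<lambda>P. rpoly P \<alpha>)"

definition A where "A = {x \<in> K. algebraic_int x}"

lemma K_gens: "c \<in> K" "\<tau> \<in> K" "s \<in> K" "of_rat q \<in> K"
  unfolding K_def
  using range_eqI[of c "\<lambda>P. rpoly P \<alpha>" "Polynomial.monom (of_int \<epsilon>) 4"]
    range_eqI[of \<tau> "\<lambda>P. rpoly P \<alpha>" "Polynomial.monom 1 3"]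
    range_eqI[of s "\<lambda>P. rpoly P \<alpha>" "Polynomial.monom 1 6"]
    range_eqI[of "of_rat q" "\<lambda>P. rpoly P \<alpha>" "[:q:]"]
  by (simp_all add: c_def \<tau>_def s_def)

lemma K_ring: "x \<in> K \<Longrightarrow> y \<in> K \<Longrightarrow> x + y \<in> K" "x \<in> K \<Longrightarrow> y \<in> K \<Longrightarrow> x - y \<in> K"
    "x \<in> K \<Longrightarrow> y \<in> K \<Longrightarrow> x * y \<in> K" "x \<in> K \<Longrightarrow> x ^ n \<in> K" "of_int z \<in> K"
    "1 \<in> K" "0 \<in> K" "numeral k \<in> K"
proof -
  show "x \<in> K \<Longrightarrow> y \<in> K \<Longrightarrow> x + y \<in> K" "x \<in> K \<Longrightarrow> y \<in> K \<Longrightarrow> x - y \<in> K"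
    and mult: "x \<in> K \<Longrightarrow> y \<in> K \<Longrightarrow> x * y \<in> K" for x y
    unfolding K_def by (metis (no_types, lifting) rangeE rangeI rpoly_simps)+
  have one: "1 \<in> K" using K_gens(4)[of 1] by simp
  show "x \<in> K \<Longrightarrow> x ^ n \<in> K" by (induction n) (auto simp: one mult)
  show "of_int z \<in> K" using K_gens(4)[of "of_int z"] by simp
  show "1 \<in> K" by fact
  show "0 \<in> K" using K_gens(4)[of 0] by simp
  show "numeral k \<in> K" using K_gens(4)[of "numeral k"] by simp
qed

lemma K_divide_int: "x \<in> K \<Longrightarrow> x / of_int z \<in> K"
  using K_ring(3)[OF _ K_gens(4)[of "1 / of_int z"], of x] by (simp add: of_rat_divide)

text \<open>Horner's scheme: multiplication by \<open>\<alpha> = (\<tau> ^ 3 / M) * c\<close> moves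
  the three coordinates cyclically, with \<open>c ^ 3 = M\<close> at the wrap.\<close>

lemma K_decompose_cubic:
  assumes "x \<in> K"
  shows "\<exists>Z0 Z1 Z2. x = rpoly Z0 \<tau> + rpoly Z1 \<tau> * c + rpoly Z2 \<tau> * c ^ 2"
proof -
  obtain P where "x = rpoly P \<alpha>" using assms by (auto simp: K_def)
  moreover have "\<exists>Z0 Z1 Z2. rpoly P \<alpha> = rpoly Z0 \<tau> + rpoly Z1 \<tau> * c + rpoly Z2 \<tau> * c ^ 2"
  proof (induction P)
    case 0
    show ?case by (intro exI[of _ 0]) simp
  next
    case (pCons a P)
    then obtain Z0 Z1 Z2 where Z: "rpoly P \<alpha> = rpoly Z0 \<tau> + rpoly Z1 \<tau> * c + rpoly Z2 \<tau> * c ^ 2"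
      by blast
    define T where "T = Polynomial.monom (1 / of_int M :: rat) 3"
    have T: "\<alpha> = rpoly T \<tau> * c"
      using tau_c_alpha M_nonzero by (simp add: T_def of_rat_divide field_simps)
    have "rpoly (pCons a P) \<alpha> = of_rat a + rpoly T \<tau> * (rpoly Z0 \<tau> * c + rpoly Z1 \<tau> * c ^ 2 + rpoly Z2 \<tau> * c ^ 3)"
      unfolding rpoly_pCons Z by (subst T) (simp add: algebra_simps power2_eq_square power3_eq_cube)
    also have "\<dots> = rpoly ([:a:] + smult (of_int M) (T * Z2)) \<tau> + rpoly (T * Z0) \<tau> * c + rpoly (T * Z1) \<tau> * c ^ 2"
      unfolding c_cube rpoly_simps by (simp add: algebra_simps)
    finally show ?case by blast
  qed
  ultimately show ?thesis by blast
qed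

text \<open>Here \<open>\<alpha> = (c / M) * \<tau> ^ 3\<close>, and the factor
  \<open>\<tau> ^ 3\<close> moves the four coordinates one place back, with
  \<open>\<tau> ^ 4 = m\<close> at the wrap.\<close>

lemma K_decompose_quartic:
  assumes "x \<in> K"
  shows "\<exists>Y0 Y1 Y2 Y3. x = rpoly Y0 c + rpoly Y1 c * \<tau> + rpoly Y2 c * \<tau> ^ 2 + rpoly Y3 c * \<tau> ^ 3"
proof -
  obtain P where "x = rpoly P \<alpha>" using assms by (auto simp: K_def)
  moreover have "\<exists>Y0 Y1 Y2 Y3. rpoly P \<alpha> = rpoly Y0 c + rpoly Y1 c * \<tau> + rpoly Y2 c * \<tau> ^ 2 + rpoly Y3 c * \<tau> ^ 3"
  proof (induction P)
    case 0
    show ?case by (intro exI[of _ 0]) simp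
  next
    case (pCons a P)
    then obtain Y0 Y1 Y2 Y3
      where Y: "rpoly P \<alpha> = rpoly Y0 c + rpoly Y1 c * \<tau> + rpoly Y2 c * \<tau> ^ 2 + rpoly Y3 c * \<tau> ^ 3"
      by blast
    define T where "T = [:0, 1 / of_int M :: rat:]"
    have T: "\<alpha> = rpoly T c * \<tau> ^ 3"
      using tau_c_alpha M_nonzero by (simp add: T_def of_rat_divide field_simps)
    have "rpoly (pCons a P) \<alpha> = of_rat a + rpoly T c * (rpoly Y0 c * \<tau> ^ 3 + \<tau> ^ 4 * (rpoly Y1 c + rpoly Y2 c * \<tau> + rpoly Y3 c * \<tau> ^ 2))"
      unfolding rpoly_pCons Y by (subst T) (simp add: algebra_simps power2_eq_square power3_eq_cube power4_eq_xxxx)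
    also have "\<dots> = rpoly ([:a:] + smult (of_int m) (T * Y1)) c + rpoly (smult (of_int m) (T * Y2)) c * \<tau>
        + rpoly (smult (of_int m) (T * Y3)) c * \<tau> ^ 2 + rpoly (T * Y0) c * \<tau> ^ 3"
      unfolding tau_four rpoly_simps by (simp add: algebra_simps)
    finally show ?case by blast
  qed
  ultimately show ?thesis by blast
qed

lemma rpoly_tau_cases: "\<exists>a0 a1 a2 a3. rpoly Z \<tau> = rpoly [:a0, a1, a2, a3:] \<tau>"
proof (induction Z)
  case 0
  show ?case by (intro exI[of _ 0]) simp
next
  case (pCons a Z)
  then obtain a0 a1 a2 a3 where Z: "rpoly Z \<tau> = rpoly [:a0, a1, a2, a3:] \<tau>" by blast
  have "rpoly (pCons a Z) \<tau> = of_rat a + of_rat a0 * \<tau> + of_rat a1 * \<tau> ^ 2 + of_rat a2 * \<tau> ^ 3 + of_rat a3 * \<tau> ^ 4"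
    unfolding rpoly_pCons[of a Z] Z by (simp add: algebra_simps power2_eq_square power3_eq_cube power4_eq_xxxx)
  also have "\<dots> = rpoly [:a + a3 * of_int m, a0, a1, a2:] \<tau>"
    unfolding tau_four by (simp add: algebra_simps power2_eq_square power3_eq_cube of_rat_add of_rat_mult)
  finally show ?case by blast
qed

lemma rpoly_c_cases: "\<exists>a0 a1 a2. rpoly Y c = rpoly [:a0, a1, a2:] c"
proof (induction Y)
  case 0
  show ?case by (intro exI[of _ 0]) simp
next
  case (pCons a Z)
  then obtain a0 a1 a2 where Z: "rpoly Z c = rpoly [:a0, a1, a2:] c" by blast
  have "rpoly (pCons a Z) c = of_rat a + of_rat a0 * c + of_rat a1 * c ^ 2 + of_rat a2 * c ^ 3"
    unfolding rpoly_pCons[of a Z] Z by (simp add: algebra_simps power2_eq_square power3_eq_cube)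
  also have "\<dots> = rpoly [:a + a2 * of_int M, a0, a1:] c"
    unfolding c_cube by (simp add: algebra_simps power2_eq_square of_rat_add of_rat_mult)
  finally show ?case by blast
qed

section \<open>Partial traces to the two subfields\<close>

text \<open>Replacing \<open>\<alpha>\<close> by \<open>z * \<alpha>\<close> with
  \<open>z ^ 3 = 1\<close> fixes \<open>\<tau>\<close> and multiplies \<open>c\<close> by
  \<open>z ^ 4 = z\<close>. Summing over the three \<open>z\<close> cancels the coordinates of
  \<open>c\<close> and \<open>c ^ 2\<close>.\<close>

lemma trace_cubic_integral:
  assumes "algebraic_int (rpoly Z0 \<tau> + rpoly Z1 \<tau> * c + rpoly Z2 \<tau> * c ^ 2)"
  shows "algebraic_int (3 * rpoly Z0 \<tau>)"
proof -
  define \<omega> where "\<omega> = (csqrt (- 3) - 1) / 2"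
  have sq: "csqrt (- 3) * csqrt (- 3) = - 3"
    using power2_csqrt[of "- 3"] by (simp add: power2_eq_square)
  have "\<omega> ^ 2 = ((csqrt (- 3) * csqrt (- 3)) - 2 * csqrt (- 3) + 1) / 4"
    by (simp add: \<omega>_def power2_eq_square field_simps)
  then have \<omega>: "\<omega> ^ 2 = - 1 - \<omega>"
    unfolding sq by (simp add: \<omega>_def field_simps)
  have \<omega>3: "\<omega> ^ 3 = 1"
  proof -
    have "\<omega> ^ 3 = \<omega> * \<omega> ^ 2" by (simp add: power3_eq_cube power2_eq_square)
    also have "\<dots> = - \<omega> - \<omega> ^ 2" unfolding \<omega> by (simp add: algebra_simps power2_eq_square \<omega>[unfolded power2_eq_square])
    finally show ?thesis by (simp add: \<omega>)
  qed
  define P where "P = pcompose Z0 (Polynomial.monom 1 3)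
    + pcompose Z1 (Polynomial.monom 1 3) * Polynomial.monom (of_int \<epsilon>) 4
    + pcompose Z2 (Polynomial.monom 1 3) * Polynomial.monom 1 8"
  have P: "rpoly P (z * \<alpha>) = rpoly Z0 \<tau> + rpoly Z1 \<tau> * c * z + rpoly Z2 \<tau> * c ^ 2 * z ^ 2" if "z ^ 3 = 1" for z
  proof -
    have z4: "z ^ 4 = z" using that by (simp add: power3_eq_cube power4_eq_xxxx)
    have "z ^ 8 = (z ^ 4) ^ 2" by (simp flip: power_mult)
    then have z8: "z ^ 8 = z ^ 2" by (simp add: z4)
    have "(of_int \<epsilon> :: complex) ^ 2 = 1" by (simp add: power2_eq_square)
    then show ?thesis
      using that by (simp add: P_def power_mult_distrib z4 z8 \<tau>_def c_def mult_ac flip: power_mult)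
  qed
  have int: "algebraic_int (rpoly P (z * \<alpha>))" if "z ^ 3 = 1" for z
  proof (rule algebraic_int_conjugate)
    show "algebraic_int (rpoly P \<alpha>)" using assms P[of 1] by simp
    have "z ^ 12 = (z ^ 3) ^ 4" by (simp flip: power_mult)
    then show "z ^ 12 = 1" using that by simp
  qed
  have \<omega>6: "(\<omega> ^ 2) ^ 3 = 1"
    using \<omega>3 by (metis power_commutes power_mult mult.commute power_one)
  have \<omega>4: "(\<omega> ^ 2) ^ 2 = \<omega>"
    unfolding \<omega> by (simp add: power2_eq_square algebra_simps \<omega>[unfolded power2_eq_square])
  have "rpoly P (1 * \<alpha>) + rpoly P (\<omega> * \<alpha>) + rpoly P (\<omega> ^ 2 * \<alpha>) = 3 * rpoly Z0 \<tau>"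
    unfolding P[OF \<omega>3] P[OF \<omega>6] P[OF power_one] \<omega>4 by (simp add: \<omega> algebra_simps)
  then show ?thesis using int[OF \<omega>3] int[OF \<omega>6] int[OF power_one] by (metis algebraic_int_simps(1))
qed

text \<open>Replacing \<open>\<alpha>\<close> by \<open>z * \<alpha>\<close> with
  \<open>z ^ 4 = 1\<close> fixes \<open>c\<close> and multiplies \<open>\<tau>\<close> by
  \<open>z ^ 3\<close>, which again runs through the fourth roots of unity.\<close>

lemma trace_quartic_integral:
  assumes "algebraic_int (rpoly Y0 c + rpoly Y1 c * \<tau> + rpoly Y2 c * \<tau> ^ 2 + rpoly Y3 c * \<tau> ^ 3)"
  shows "algebraic_int (4 * rpoly Y0 c)"
proof -
  define Q where "Q = Polynomial.monom (of_int \<epsilon> :: rat) 4"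
  define P where "P = pcompose Y0 Q + pcompose Y1 Q * Polynomial.monom 1 3
    + pcompose Y2 Q * Polynomial.monom 1 6 + pcompose Y3 Q * Polynomial.monom 1 9"
  have P: "rpoly P (z * \<alpha>) = rpoly Y0 c + rpoly Y1 c * \<tau> * z ^ 3 + rpoly Y2 c * \<tau> ^ 2 * z ^ 2 + rpoly Y3 c * \<tau> ^ 3 * z"
    if "z ^ 4 = 1" for z
  proof -
    have "z ^ 6 = z ^ 4 * z ^ 2" by (simp flip: power_add)
    then have z6: "z ^ 6 = z ^ 2" using that by simp
    have "z ^ 9 = z ^ 4 * z ^ 4 * z" by (simp flip: power_add power_Suc2)
    then have z9: "z ^ 9 = z" using that by simp
    show ?thesis
      using that by (simp add: P_def Q_def power_mult_distrib z6 z9 \<tau>_def c_def mult_ac flip: power_mult)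
  qed
  have int: "algebraic_int (rpoly P (z * \<alpha>))" if "z ^ 4 = 1" for z
  proof (rule algebraic_int_conjugate)
    show "algebraic_int (rpoly P \<alpha>)" using assms P[of 1] by simp
    have "z ^ 12 = (z ^ 4) ^ 3" by (simp flip: power_mult)
    then show "z ^ 12 = 1" using that by simp
  qed
  have i: "\<i> ^ 4 = 1" "(- \<i>) ^ 4 = 1" "(- 1 :: complex) ^ 4 = 1" by (simp_all add: power4_eq_xxxx)
  have "rpoly P (1 * \<alpha>) + rpoly P (\<i> * \<alpha>) + rpoly P (- 1 * \<alpha>) + rpoly P (- \<i> * \<alpha>) = 4 * rpoly Y0 c"
    unfolding P[OF i(1)] P[OF i(2)] P[OF i(3)] P[OF power_one]
    by (simp add: algebra_simps power2_eq_square power3_eq_cube)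
  then show ?thesis
    using int[OF i(1)] int[OF i(2)] int[OF i(3)] int[OF power_one] by (metis algebraic_int_simps(1))
qed

text \<open>Multiplying \<open>x\<close> by 1, \<open>c\<close> and \<open>c ^ 2\<close> brings each
  coordinate into the constant place, where the trace shows three times it to be integral. The wrap
  \<open>c ^ 3 = M\<close> accounts for the factor \<open>M\<close>.\<close>

lemma integral_decompose_cubic:
  assumes "x \<in> A"
  shows "\<exists>Z0 Z1 Z2. of_int (3 * M) * x = rpoly Z0 \<tau> + rpoly Z1 \<tau> * c + rpoly Z2 \<tau> * c ^ 2
    \<and> algebraic_int (rpoly Z0 \<tau>) \<and> algebraic_int (rpoly Z1 \<tau>) \<and> algebraic_int (rpoly Z2 \<tau>)"
proof -
  obtain Z0 Z1 Z2 where x: "x = rpoly Z0 \<tau> + rpoly Z1 \<tau> * c + rpoly Z2 \<tau> * c ^ 2"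
    using K_decompose_cubic assms unfolding A_def by blast
  have int: "algebraic_int x" using assms by (simp add: A_def)
  have c3: "c * (c * c) = of_int M" "c * (c * (c * y)) = of_int M * y" for y
    unfolding c_cube[symmetric] by (simp_all add: power3_eq_cube mult.assoc)
  have "c * x = rpoly (smult (of_int M) Z2) \<tau> + rpoly Z0 \<tau> * c + rpoly Z1 \<tau> * c ^ 2"
    unfolding x by (simp add: c3 power2_eq_square algebra_simps)
  moreover have "c ^ 2 * x = rpoly (smult (of_int M) Z1) \<tau> + rpoly (smult (of_int M) Z2) \<tau> * c + rpoly Z0 \<tau> * c ^ 2"
    unfolding x by (simp add: c3 power2_eq_square algebra_simps)
  moreover have "algebraic_int (c * x)" "algebraic_int (c ^ 2 * x)" using int by simp_all
  ultimately have i: "algebraic_int (3 * rpoly Z0 \<tau>)" "algebraic_int (3 * rpoly (smult (of_int M) Z2) \<tau>)"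
      "algebraic_int (3 * rpoly (smult (of_int M) Z1) \<tau>)"
    using trace_cubic_integral int unfolding x by metis+
  have "of_int (3 * M) * x = rpoly (smult (of_int (3 * M)) Z0) \<tau> + rpoly (smult (of_int (3 * M)) Z1) \<tau> * c
      + rpoly (smult (of_int (3 * M)) Z2) \<tau> * c ^ 2"
    unfolding x rpoly_simps by (simp add: algebra_simps of_rat_mult)
  moreover have "algebraic_int (rpoly (smult (of_int (3 * M)) Z0) \<tau>)"
    using algebraic_int_simps(3)[OF algebraic_int_simps(5)[of M] i(1)] by (simp add: mult_ac of_rat_mult)
  moreover have "algebraic_int (rpoly (smult (of_int (3 * M)) Z1) \<tau>)"
      "algebraic_int (rpoly (smult (of_int (3 * M)) Z2) \<tau>)"
    using i by (simp_all add: mult_ac of_rat_mult)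
  ultimately show ?thesis by blast
qed

lemma integral_decompose_quartic:
  assumes "x \<in> A"
  shows "\<exists>Y0 Y1 Y2 Y3. of_int (4 * m) * x = rpoly Y0 c + rpoly Y1 c * \<tau> + rpoly Y2 c * \<tau> ^ 2 + rpoly Y3 c * \<tau> ^ 3
    \<and> algebraic_int (rpoly Y0 c) \<and> algebraic_int (rpoly Y1 c) \<and> algebraic_int (rpoly Y2 c) \<and> algebraic_int (rpoly Y3 c)"
proof -
  obtain Y0 Y1 Y2 Y3
    where x: "x = rpoly Y0 c + rpoly Y1 c * \<tau> + rpoly Y2 c * \<tau> ^ 2 + rpoly Y3 c * \<tau> ^ 3"
    using K_decompose_quartic assms unfolding A_def by blast
  have int: "algebraic_int x" using assms by (simp add: A_def)
  have t4: "\<tau> * (\<tau> * (\<tau> * \<tau>)) = of_int m" "\<tau> * (\<tau> * (\<tau> * (\<tau> * y))) = of_int m * y" for y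
    unfolding tau_four[symmetric] by (simp_all add: power4_eq_xxxx mult.assoc)
  have "\<tau> * x = rpoly (smult (of_int m) Y3) c + rpoly Y0 c * \<tau> + rpoly Y1 c * \<tau> ^ 2 + rpoly Y2 c * \<tau> ^ 3"
    unfolding x by (simp add: t4 power2_eq_square power3_eq_cube algebra_simps)
  moreover have "\<tau> ^ 2 * x = rpoly (smult (of_int m) Y2) c + rpoly (smult (of_int m) Y3) c * \<tau> + rpoly Y0 c * \<tau> ^ 2 + rpoly Y1 c * \<tau> ^ 3"
    unfolding x by (simp add: t4 power2_eq_square power3_eq_cube algebra_simps)
  moreover have "\<tau> ^ 3 * x = rpoly (smult (of_int m) Y1) c + rpoly (smult (of_int m) Y2) c * \<tau> + rpoly (smult (of_int m) Y3) c * \<tau> ^ 2 + rpoly Y0 c * \<tau> ^ 3"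
    unfolding x by (simp add: t4 power2_eq_square power3_eq_cube algebra_simps)
  moreover have "algebraic_int (\<tau> * x)" "algebraic_int (\<tau> ^ 2 * x)" "algebraic_int (\<tau> ^ 3 * x)" using int by simp_all
  ultimately have i: "algebraic_int (4 * rpoly Y0 c)" "algebraic_int (4 * rpoly (smult (of_int m) Y1) c)"
      "algebraic_int (4 * rpoly (smult (of_int m) Y2) c)" "algebraic_int (4 * rpoly (smult (of_int m) Y3) c)"
    using trace_quartic_integral int unfolding x by metis+
  have "of_int (4 * m) * x = rpoly (smult (of_int (4 * m)) Y0) c + rpoly (smult (of_int (4 * m)) Y1) c * \<tau>
      + rpoly (smult (of_int (4 * m)) Y2) c * \<tau> ^ 2 + rpoly (smult (of_int (4 * m)) Y3) c * \<tau> ^ 3"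
    unfolding x rpoly_simps by (simp add: algebra_simps of_rat_mult)
  moreover have "algebraic_int (rpoly (smult (of_int (4 * m)) Y0) c)"
    using algebraic_int_simps(3)[OF algebraic_int_simps(5)[of m] i(1)] by (simp add: mult_ac of_rat_mult)
  moreover have "algebraic_int (rpoly (smult (of_int (4 * m)) Y1) c)"
      "algebraic_int (rpoly (smult (of_int (4 * m)) Y2) c)" "algebraic_int (rpoly (smult (of_int (4 * m)) Y3) c)"
    using i by (simp_all add: mult_ac of_rat_mult)
  ultimately show ?thesis by blast
qed

text \<open>The conjugation \<open>\<alpha> \<mapsto> k ^ 3 * \<alpha>\<close> acts on
  \<open>\<tau>\<close> as multiplication by \<open>k ^ 9 = k\<close>.\<close>

lemma conjugate_tau:
  assumes "algebraic_int (rpoly Z \<tau>)" "k ^ 4 = 1"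
  shows "algebraic_int (rpoly Z (k * \<tau>))"
proof -
  have "algebraic_int (rpoly (pcompose Z (Polynomial.monom 1 3)) (k ^ 3 * \<alpha>))"
  proof (rule algebraic_int_conjugate)
    have "(k ^ 3) ^ 12 = (k ^ 4) ^ 9" by (simp flip: power_mult)
    then show "(k ^ 3) ^ 12 = 1" using assms by simp
  qed (use assms in \<open>simp add: \<tau>_def\<close>)
  moreover have "(k ^ 3 * \<alpha>) ^ 3 = k * \<tau>"
  proof -
    have "(k ^ 3) ^ 3 = k ^ 4 * k ^ 4 * k" by (simp flip: power_mult power_add power_Suc2)
    then show ?thesis using assms by (simp add: power_mult_distrib \<tau>_def)
  qed
  ultimately show ?thesis by simp
qed

text \<open>\<open>12 * a0\<close> is the trace from \<open>K\<close> to the rationals, taken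
  through the quartic field. Its integrality is the test by which elements are shown not to be
  divisible by 3.\<close>

lemma trace_integral:
  assumes "algebraic_int (rpoly Z0 \<tau> + rpoly Z1 \<tau> * c + rpoly Z2 \<tau> * c ^ 2)"
    and "Z0 = [:a0, a1, a2, a3:]"
  shows "\<exists>z. 12 * a0 = of_int z"
proof -
  have "algebraic_int (3 * rpoly Z0 \<tau>)" by (rule trace_cubic_integral[OF assms(1)])
  moreover have "3 * rpoly Z0 \<tau> = rpoly [:3 * a0:] c + rpoly [:3 * a1:] c * \<tau> + rpoly [:3 * a2:] c * \<tau> ^ 2 + rpoly [:3 * a3:] c * \<tau> ^ 3"
    by (simp add: assms(2) algebra_simps power2_eq_square power3_eq_cube of_rat_mult)
  ultimately have "algebraic_int (4 * rpoly [:3 * a0:] c)" using trace_quartic_integral by metis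
  then have "algebraic_int (of_rat (12 * a0) :: complex)" by (simp add: of_rat_mult)
  then show ?thesis using algebraic_int_of_rat by metis
qed

end

subsection \<open>Integer polynomials modulo a prime at a generator\<close>

lemma content_eq_1_if_monic:
  fixes q :: "int poly"
  assumes "lead_coeff q = 1"
  shows "content q = 1"
proof -
  have "content q dvd lead_coeff q" by (rule content_dvd_coeff)
  then show ?thesis using assms by (metis abs_dvd_iff content_1 is_unit_normalize normalize_content)
qed

text \<open>Gauss's lemma: a primitive annihilator \<open>H\<close> of least degree divides the
  monic \<open>q\<close> after pseudo-division, because the scaling constant \<open>C\<close> is
  absorbed by the content of the cofactor. Hence \<open>H\<close> has leading coefficient 1 or
  -1.\<close>

lemma monic_int_min_poly:
  assumes "algebraic_int x"
  obtains G where "lead_coeff G = 1" "ipoly G x = 0"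
    "\<And>Q. ipoly Q x = 0 \<Longrightarrow> degree Q < degree G \<Longrightarrow> Q = 0"
proof -
  obtain q where q: "ipoly q x = 0" "lead_coeff q = 1"
    using assms unfolding algebraic_int_altdef_ipoly by blast
  define D where "D = (\<lambda>n. \<exists>P. P \<noteq> 0 \<and> ipoly P x = 0 \<and> degree P = n)"
  have "q \<noteq> 0" using q by auto
  then have "D (degree q)" unfolding D_def using q by blast
  then have "D (LEAST n. D n)" by (rule LeastI)
  then obtain P where P: "P \<noteq> 0" "ipoly P x = 0" "degree P = (LEAST n. D n)" unfolding D_def by blast
  have least: "Q = 0" if "ipoly Q x = 0" "degree Q < degree P" for Q
    using that not_less_Least[of "degree Q" D] unfolding P(3) D_def by blast
  define H where "H = primitive_part P"
  have H0: "H \<noteq> 0" and degH: "degree H = degree P" and contH: "content H = 1"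
    using P by (simp_all add: H_def)
  have "ipoly P x = of_int (content P) * ipoly H x"
    by (subst content_times_primitive_part[of P, symmetric]) (simp only: ipoly_simps H_def)
  then have H: "ipoly H x = 0" using P by simp
  obtain h r where hr: "pseudo_divmod q H = (h, r)" by (cases "pseudo_divmod q H")
  define C where "C = lead_coeff H ^ (Suc (degree q) - degree H)"
  have eq: "smult C q = H * h + r" and r: "r = 0 \<or> degree r < degree H"
    using pseudo_divmod[OF H0 hr] by (auto simp: C_def)
  have "ipoly r x = ipoly (smult C q - H * h) x" by (simp add: eq)
  also have "\<dots> = 0" using H q by (simp only: ipoly_simps) simp
  finally have "r = 0" using least r degH by auto
  then have eq: "smult C q = H * h" using eq by simp
  have C0: "C \<noteq> 0" using H0 by (simp add: C_def)
  have "content (smult C q) = content h" unfolding eq by (simp add: content_mult contH)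
  then have "\<bar>C\<bar> = content h" using content_eq_1_if_monic[OF q(2)] by simp
  then have "C dvd content h" by (metis abs_dvd_iff dvd_refl)
  then obtain h' where h': "h = smult C h'"
    using const_poly_dvd_iff_dvd_content[of C h] by (auto elim: dvdE)
  then have "smult C q = smult C (H * h')" using eq by simp
  then have "q = H * h'" using C0 by (metis smult_cancel)
  then have "lead_coeff H * lead_coeff h' = 1" using q(2) by (simp add: lead_coeff_mult)
  then have lc: "lead_coeff H = 1 \<or> lead_coeff H = - 1" by (rule pos_zmult_eq_1_iff_lemma)
  define G where "G = smult (lead_coeff H) H"
  show ?thesis
  proof (rule that)
    show "lead_coeff G = 1" using lc by (auto simp: G_def)
    show "ipoly G x = 0" using H by (simp only: G_def ipoly_simps) simp
    show "Q = 0" if "ipoly Q x = 0" "degree Q < degree G" for Q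
      using least[OF that(1)] that(2) lc degH by (auto simp: G_def)
  qed
qed

lemma monic_int_division:
  fixes f g :: "int poly"
  assumes "lead_coeff g = 1"
  obtains q r where "f = g * q + r" "r = 0 \<or> degree r < degree g"
proof -
  obtain q r where qr: "pseudo_divmod f g = (q, r)" by (cases "pseudo_divmod f g")
  have "g \<noteq> 0" using assms by auto
  then have "smult (lead_coeff g ^ (Suc (degree f) - degree g)) f = g * q + r \<and> (r = 0 \<or> degree r < degree g)"
    using pseudo_divmod[OF _ qr] by blast
  then show ?thesis using that assms by simp
qed

text \<open>The \<open>n\<close> independent powers of \<open>y\<close> lie in the rational span of
  the powers of \<open>x\<close> below \<open>degree G\<close>. With \<open>\<theta>\<close> for
  \<open>x\<close> and \<open>\<alpha>\<close> for \<open>y\<close> it bounds the degree of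
  \<open>\<theta>\<close> from below by 12.\<close>

lemma rational_dimension_bound:
  fixes x y :: complex
  assumes G: "G \<noteq> 0" "rpoly G x = 0"
    and gen: "\<And>i. i < n \<Longrightarrow> \<exists>P. y ^ i = rpoly P x"
    and indep: "\<And>a. (\<Sum>i<n. of_rat (a i) * y ^ i) = 0 \<Longrightarrow> \<forall>i<n. a i = 0"
  shows "n \<le> degree G"
proof -
  interpret V: vector_space "\<lambda>(q::rat) (z::complex). of_rat q * z"
    by unfold_locales (simp_all add: algebra_simps of_rat_add of_rat_mult)
  define B where "B = (\<lambda>i. x ^ i) ` {..<degree G}"
  have span: "rpoly P x \<in> V.span B" for P
  proof -
    define r where "r = P mod G"
    have "rpoly P x = rpoly (G * (P div G) + P mod G) x" by simp
    also have "\<dots> = rpoly r x" using G by (simp only: rpoly_simps r_def) simp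
    finally have Pr: "rpoly P x = rpoly r x" .
    show ?thesis
    proof (cases "r = 0")
      case True
      then show ?thesis unfolding Pr by (simp add: V.span_zero)
    next
      case False
      then have "degree r < degree G" using degree_mod_less[OF G(1), of P] by (simp add: r_def)
      then show ?thesis
        unfolding Pr rpoly_eq_sum[OF \<open>degree r < degree G\<close>]
        by (intro V.span_sum V.span_scale V.span_base) (auto simp: B_def)
    qed
  qed
  \<comment> \<open>Independence in a vector space concerns sets, so the powers must first be seen
    to be distinct.\<close>
  have inj: "inj_on (\<lambda>i. y ^ i) {..<n}"
  proof (rule inj_onI, rule ccontr)
    fix i j assume ij: "i \<in> {..<n}" "j \<in> {..<n}" "y ^ i = y ^ j" "i \<noteq> j"
    define a where "a = (\<lambda>k. if k = i then 1 else if k = j then - 1 else 0 :: rat)"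
    have "(\<Sum>k<n. of_rat (a k) * y ^ k) = (\<Sum>k\<in>{i, j}. of_rat (a k) * y ^ k)"
      using ij by (intro sum.mono_neutral_right) (auto simp: a_def)
    also have "\<dots> = 0" using ij by (simp add: a_def)
    finally have "a i = 0" using indep ij by blast
    then show False by (simp add: a_def)
  qed
  define S where "S = (\<lambda>i. y ^ i) ` {..<n}"
  have "V.independent S"
  proof
    assume "V.dependent S"
    then obtain u v where u: "v \<in> S" "u v \<noteq> 0" "(\<Sum>v\<in>S. of_rat (u v) * v) = 0"
      by (subst (asm) V.dependent_finite) (auto simp: S_def)
    have "(\<Sum>v\<in>S. of_rat (u v) * v) = (\<Sum>i<n. of_rat (u (y ^ i)) * y ^ i)"
      unfolding S_def by (subst sum.reindex[OF inj]) simp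
    then have "\<forall>i<n. u (y ^ i) = 0" using u(3) indep[of "\<lambda>i. u (y ^ i)"] by simp
    then show False using u by (auto simp: S_def)
  qed
  moreover have "S \<subseteq> V.span B"
  proof
    fix z assume "z \<in> S"
    then obtain i where "i < n" "z = y ^ i" by (auto simp: S_def)
    then show "z \<in> V.span B" using gen[of i] span by auto
  qed
  ultimately have "card S \<le> card B"
    using V.independent_span_bound[of B S] by (simp add: B_def)
  moreover have "card S = n" unfolding S_def by (simp add: card_image inj)
  moreover have "card B \<le> degree G" unfolding B_def using card_image_le[of "{..<degree G}"] by simp
  ultimately show ?thesis by simp
qed

locale pure12_monogenic = pure12_tower +
  fixes \<theta> :: complex
  assumes theta_A: "\<theta> \<in> A" and generated: "\<And>x. x \<in> A \<Longrightarrow> \<exists>P. x = ipoly P \<theta>"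
begin

lemma theta_integral [simp]: "algebraic_int \<theta>" and theta_K: "\<theta> \<in> K"
  using theta_A by (simp_all add: A_def)

lemma ipoly_theta_K: "ipoly P \<theta> \<in> K"
  by (induction P) (auto simp: hom_distribs K_ring theta_K)

lemma alpha_A: "\<alpha> \<in> A"
  unfolding A_def K_def using range_eqI[of \<alpha> "\<lambda>P. rpoly P \<alpha>" "[:0, 1:]"] by simp

text \<open>The quotient lies in \<open>A\<close>, hence is \<open>R(\<theta>)\<close> with
  \<open>R\<close> reduced modulo the monic minimal polynomial \<open>G\<close>. Then
  \<open>Q - p * R\<close> annihilates \<open>\<theta>\<close> in degree below that of
  \<open>G\<close>, so it vanishes.\<close>

lemma divisible_coeffs:
  assumes deg: "degree Q < 12" and p: "p \<noteq> 0" and int: "algebraic_int (ipoly Q \<theta> / of_int p)"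
  shows "\<exists>R. Q = smult p R"
proof -
  obtain G where G: "lead_coeff G = 1" "ipoly G \<theta> = 0"
      "\<And>Q. ipoly Q \<theta> = 0 \<Longrightarrow> degree Q < degree G \<Longrightarrow> Q = 0"
    using monic_int_min_poly[OF theta_integral] by blast
  have "12 \<le> degree (map_poly of_int G :: rat poly)"
  proof (rule rational_dimension_bound)
    show "(map_poly of_int G :: rat poly) \<noteq> 0" using G(1) by auto
    show "rpoly (map_poly of_int G) \<theta> = 0" using G(2) by simp
    show "\<exists>P. \<alpha> ^ i = rpoly P \<theta>" for i
    proof -
      have "\<alpha> ^ i \<in> A" using alpha_A K_ring(4)[of \<alpha> i] by (simp add: A_def)
      then obtain P where "\<alpha> ^ i = ipoly P \<theta>" using generated by blast
      then have "\<alpha> ^ i = rpoly (map_poly of_int P) \<theta>" by simp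
      then show ?thesis by blast
    qed
  qed (use rat_sum_independent in blast)
  then have deg12: "12 \<le> degree G" by simp
  have "ipoly Q \<theta> / of_int p \<in> A"
    unfolding A_def using int ipoly_theta_K K_divide_int by blast
  then obtain R0 where R0: "ipoly Q \<theta> / of_int p = ipoly R0 \<theta>" using generated by blast
  obtain q R where R: "R0 = G * q + R" "R = 0 \<or> degree R < degree G"
    using monic_int_division[OF G(1)] by blast
  have "ipoly R0 \<theta> = ipoly R \<theta>" unfolding R(1) ipoly_simps using G(2) by simp
  then have "ipoly (Q - smult p R) \<theta> = 0"
    unfolding ipoly_simps using R0 p by (simp add: field_simps)
  moreover have "degree (Q - smult p R) < degree G"
    using deg deg12 R(2) p by (intro degree_diff_less) auto
  ultimately have "Q - smult p R = 0" by (rule G(3))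
  then show ?thesis by auto
qed

end

subsection \<open>The prime 2\<close>

text \<open>These elements form a ring: exponents that are powers of 2 are additive modulo 2. It
  therefore suffices to test generators.\<close>

definition frobenius2 :: "complex set" where
  "frobenius2 = {x. algebraic_int x \<and> algebraic_int ((x ^ 8 - x ^ 2) / 2)}"

lemma frobenius2_add:
  assumes "x \<in> frobenius2" "y \<in> frobenius2"
  shows "x + y \<in> frobenius2"
proof -
  have eq: "((x + y) ^ 8 - (x + y) ^ 2) / 2 = (x ^ 8 - x ^ 2) / 2 + (y ^ 8 - y ^ 2) / 2
      + (4 * x ^ 7 * y + 14 * x ^ 6 * y ^ 2 + 28 * x ^ 5 * y ^ 3 + 35 * x ^ 4 * y ^ 4
        + 28 * x ^ 3 * y ^ 5 + 14 * x ^ 2 * y ^ 6 + 4 * x * y ^ 7 - x * y)"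
    by (simp add: eval_nat_numeral algebra_simps diff_divide_distrib add_divide_distrib)
  show ?thesis
    using assms unfolding frobenius2_def mem_Collect_eq eq by (intro conjI algebraic_int_simps) auto
qed

lemma frobenius2_mult:
  assumes "x \<in> frobenius2" "y \<in> frobenius2"
  shows "x * y \<in> frobenius2"
proof -
  have eq: "((x * y) ^ 8 - (x * y) ^ 2) / 2 = x ^ 8 * ((y ^ 8 - y ^ 2) / 2) + y ^ 2 * ((x ^ 8 - x ^ 2) / 2)"
    by (simp add: power_mult_distrib field_simps)
  show ?thesis
    using assms unfolding frobenius2_def mem_Collect_eq eq by (intro conjI algebraic_int_simps) auto
qed

lemma frobenius2_of_int: "of_int n \<in> frobenius2"
proof -
  have "even (n ^ 8 - n ^ 2)" by simp
  then obtain k where "n ^ 8 - n ^ 2 = 2 * k" by blast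
  then have "(of_int n ^ 8 - of_int n ^ 2 :: complex) = 2 * of_int k"
    by (metis of_int_diff of_int_mult of_int_numeral of_int_power)
  then show ?thesis by (simp add: frobenius2_def)
qed

text \<open>\<open>D ^ 8\<close> and \<open>D ^ 2\<close> are odd, so dropping them changes the
  expression by even multiples only. This disposes of the odd denominators.\<close>

lemma frobenius2_odd_cancel:
  assumes "odd D" "of_int D * x \<in> frobenius2" "algebraic_int x"
  shows "x \<in> frobenius2"
proof -
  have "odd (D ^ 8)" "odd (D ^ 2)" using assms(1) by simp_all
  then obtain a b where "D ^ 8 = 2 * a + 1" "D ^ 2 = 2 * b + 1" by (metis oddE)
  then have ab: "(of_int D :: complex) ^ 8 = 2 * of_int a + 1" "(of_int D :: complex) ^ 2 = 2 * of_int b + 1"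
    by (metis of_int_1 of_int_add of_int_mult of_int_numeral of_int_power)+
  have eq: "(x ^ 8 - x ^ 2) / 2 = ((of_int D * x) ^ 8 - (of_int D * x) ^ 2) / 2 - of_int a * x ^ 8 + of_int b * x ^ 2"
    unfolding power_mult_distrib ab by (simp add: field_simps)
  show ?thesis
    using assms unfolding frobenius2_def mem_Collect_eq eq by (intro conjI algebraic_int_simps) auto
qed

section \<open>Integers of the quartic field at 2\<close>

context pure12_tower
begin

lemma sqrt_independent:
  assumes "of_rat a + of_rat b * s = 0"
  shows "a = 0" "b = 0"
proof -
  have "rpoly [:a, 0, 0, 0, 0, 0, b:] \<alpha> = 0"
    using assms by (simp add: s_def eval_nat_numeral algebra_simps)
  then have "[:a, 0, 0, 0, 0, 0, b:] = 0" by (rule rat_poly_independent[rotated]) simp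
  then show "a = 0" "b = 0" by auto
qed

text \<open>The classical description of quadratic integers for \<open>m \<equiv> 1\<close> modulo
  4, up to the odd factor \<open>m\<close>. Trace and difference of the conjugates bound the
  denominators by 2, and the norm gives the parity relation.\<close>

lemma quadratic_integral:
  assumes l: "m = 4 * l + 1" and int: "algebraic_int (of_rat a + of_rat b * s)"
  shows "\<exists>u v. of_int m * (of_rat a + of_rat b * s) = of_int u + of_int v * ((1 + s) / 2)"
proof -
  have "rpoly [:a, 0, b:] \<tau> = of_rat a + of_rat b * s"
    by (simp add: tau_square[symmetric] power2_eq_square)
  then have "algebraic_int (rpoly [:a, 0, b:] (\<i> * \<tau>))"
    by (intro conjugate_tau) (simp_all only: int, simp add: power4_eq_xxxx)
  moreover have "(\<i> * \<tau>) * (\<i> * \<tau>) = - s"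
    using tau_square by (metis mult_minus1 power2_eq_square power2_i power_mult_distrib)
  moreover have "rpoly [:a, 0, b:] (\<i> * \<tau>) = of_rat a + of_rat b * ((\<i> * \<tau>) * (\<i> * \<tau>))"
    by simp
  ultimately have int': "algebraic_int (of_rat a - of_rat b * s)"
    by (simp only:) simp
  have "algebraic_int (of_rat (2 * a) :: complex)"
    using algebraic_int_simps(1)[OF int int'] by (simp add: of_rat_mult)
  then obtain A1 where A1: "2 * a = of_int A1" by (rule algebraic_int_of_rat)
  have ss: "s * s = of_int m" using s_square by (simp add: power2_eq_square)
  \<comment> \<open>The extra \<open>s\<close> turns the difference \<open>2 * b * s\<close> into a
    rational number, at the cost of the factor \<open>m\<close>.\<close>
  have "of_rat (2 * b * of_int m) = ((of_rat a + of_rat b * s) - (of_rat a - of_rat b * s)) * s"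
    using ss by (simp add: of_rat_mult algebra_simps)
  then have "algebraic_int (of_rat (2 * b * of_int m) :: complex)"
    by (simp only: algebraic_int_simps int int' integral_gens)
  then obtain B1 where B1: "2 * b * of_int m = of_int B1" by (rule algebraic_int_of_rat)
  have "of_rat (a ^ 2 - b ^ 2 * of_int m) = (of_rat a + of_rat b * s) * (of_rat a - of_rat b * s)"
    using ss by (simp add: of_rat_mult of_rat_diff of_rat_power algebra_simps power2_eq_square)
  then have "algebraic_int (of_rat (a ^ 2 - b ^ 2 * of_int m) :: complex)" using int int' by simp
  then obtain N where N: "a ^ 2 - b ^ 2 * of_int m = of_int N" by (rule algebraic_int_of_rat)
  have "of_int (4 * N * m) = of_int m * (2 * a) ^ 2 - (2 * b * of_int m :: rat) ^ 2"
    by (simp add: N[symmetric] power2_eq_square algebra_simps)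
  also have "\<dots> = of_int (m * A1 ^ 2 - B1 ^ 2)" unfolding A1 B1 by simp
  finally have "4 * N * m = m * A1 ^ 2 - B1 ^ 2" by (simp only: of_int_eq_iff)
  then have "even (m * A1 ^ 2 - B1 ^ 2)" by (metis dvd_mult2 dvd_triv_left even_numeral)
  then have "even (m * A1 - B1)" using l by (auto simp: even_diff)
  then obtain u where u: "m * A1 - B1 = 2 * u" by blast
  have "2 * of_rat a = (of_int A1 :: complex)" "2 * of_rat b * of_int m = (of_int B1 :: complex)"
    using A1 B1 by (metis of_rat_mult of_rat_numeral_eq of_rat_of_int_eq)+
  moreover have "of_int m * of_int A1 - of_int B1 = (2 * of_int u :: complex)"
    using u by (metis of_int_diff of_int_mult of_int_numeral)
  ultimately have "2 * (of_int m * (of_rat a + of_rat b * s)) = 2 * (of_int u + of_int B1 * ((1 + s) / 2))"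
    by (simp add: algebra_simps)
  then show ?thesis by (metis mult_cancel_left zero_neq_numeral)
qed

text \<open>With \<open>s = 2 * w - 1\<close> this is the norm of
  \<open>(a + b * w) + (p + q * w) * \<tau>\<close> to the quadratic field, in the basis 1,
  \<open>w\<close>.\<close>

lemma quadratic_coordinates:
  fixes w :: complex
  assumes "w * w = w + l"
  shows "(a + b * w) * (a + b * w) - (p + q * w) * (p + q * w) * (2 * w - 1)
    = a ^ 2 + b ^ 2 * l - 2 * l * (2 * p * q + q ^ 2) + (p ^ 2 + q ^ 2 * l)
      + (2 * a * b + b ^ 2 - 2 * (p ^ 2 + q ^ 2 * l) - (2 * p * q + q ^ 2)) * w" (is "?L = ?R")
proof -
  have "?L - ?R = (w * w - w - l) * (b ^ 2 - 4 * p * q - q ^ 2 * (2 * w + 1))"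
    by (simp add: algebra_simps power2_eq_square)
  then show ?thesis using assms by simp
qed

text \<open>The norm of \<open>rpoly Z \<tau>\<close> to the field of \<open>s\<close> is integral; comparing its coordinates modulo 4 forces
  the stated parities.\<close>

lemma quartic_integral:
  assumes l: "m = 4 * l + 1" and int: "algebraic_int (rpoly Z \<tau>)"
  shows "\<exists>t0 t1 q0 q1. 2 * of_int (m ^ 2) * rpoly Z \<tau> = of_int t0 + of_int t1 * ((1 + s) / 2)
      + (of_int q0 + of_int q1 * ((1 + s) / 2)) * \<tau>
    \<and> even t0 \<and> even q0 \<and> even (t1 - q1) \<and> even (q1 * l)"
proof -
  obtain z0 z1 z2 z3 where Z: "rpoly Z \<tau> = rpoly [:z0, z1, z2, z3:] \<tau>"
    using rpoly_tau_cases by blast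
  define z z' where "z = rpoly [:z0, z1, z2, z3:] \<tau>" and "z' = rpoly [:z0, z1, z2, z3:] (- 1 * \<tau>)"
  have iz: "algebraic_int z" using int by (simp only: z_def Z)
  have iz': "algebraic_int z'"
    unfolding z'_def by (rule conjugate_tau) (use iz in \<open>simp_all only: z_def\<close>, simp)
  have ss: "s * s = of_int m" using s_square by (simp add: power2_eq_square)
  have tt: "\<tau> * \<tau> = s" using tau_square by (simp add: power2_eq_square)
  define p q where "p = of_rat z0 + of_rat z2 * s" and "q = of_rat z1 + of_rat z3 * s"
  have zpq: "z = p + q * \<tau>" and z'pq: "z' = p - q * \<tau>"
    unfolding z_def z'_def p_def q_def tt[symmetric] by (simp_all add: algebra_simps)
  have "z + z' = of_rat (2 * z0) + of_rat (2 * z2) * s"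
    by (simp add: zpq z'pq p_def of_rat_mult algebra_simps)
  then have "algebraic_int (of_rat (2 * z0) + of_rat (2 * z2) * s)"
    using algebraic_int_simps(1)[OF iz iz'] by simp
  from quadratic_integral[OF l this] obtain t0 t1 where
    t: "of_int m * (of_rat (2 * z0) + of_rat (2 * z2) * s) = of_int t0 + of_int t1 * ((1 + s) / 2)" by blast
  \<comment> \<open>Multiplying by \<open>\<tau> * s\<close> instead of dividing by
    \<open>\<tau>\<close> isolates \<open>q\<close> without losing integrality, since
    \<open>\<tau> * \<tau> * s = m\<close>.\<close>
  have "(z - z') * \<tau> * s = 2 * q * (\<tau> * \<tau>) * s" by (simp add: zpq z'pq algebra_simps)
  also have "\<dots> = 2 * q * of_int m" by (simp add: tt ss mult.assoc)
  also have "\<dots> = of_rat (2 * z1 * of_int m) + of_rat (2 * z3 * of_int m) * s"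
    by (simp add: q_def of_rat_mult algebra_simps)
  finally have "algebraic_int (of_rat (2 * z1 * of_int m) + of_rat (2 * z3 * of_int m) * s)"
    using iz iz' by (metis algebraic_int_simps(2,3) integral_gens(2,3))
  from quadratic_integral[OF l this] obtain q0 q1 where
    q: "of_int m * (of_rat (2 * z1 * of_int m) + of_rat (2 * z3 * of_int m) * s) = of_int q0 + of_int q1 * ((1 + s) / 2)"
    by blast
  define w where "w = (1 + s) / 2"
  \<comment> \<open>One more factor \<open>m\<close> brings \<open>p\<close> to the denominator
    \<open>2 * m ^ 2\<close> that \<open>q\<close> already has.\<close>
  define T0 T1 where "T0 = m * t0" and "T1 = m * t1"
  define T Q where "T = of_int T0 + of_int T1 * w" and "Q = of_int q0 + of_int q1 * w"
  have Tp: "T = 2 * of_int (m ^ 2) * p"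
    using t by (simp add: T_def T0_def T1_def w_def[symmetric] p_def of_rat_mult power2_eq_square)
      (simp add: algebra_simps)
  have Qq: "Q = 2 * of_int (m ^ 2) * q"
    using q by (simp add: Q_def w_def[symmetric] q_def of_rat_mult power2_eq_square algebra_simps)
  have ww: "w * w = w + of_int l"
    using ss l by (simp add: w_def field_simps)
  have sw: "s = 2 * w - 1" by (simp add: w_def)
  define u v where "u = T0 ^ 2 + T1 ^ 2 * l - 2 * l * (2 * q0 * q1 + q1 ^ 2) + (q0 ^ 2 + q1 ^ 2 * l)"
    and "v = 2 * T0 * T1 + T1 ^ 2 - 2 * (q0 ^ 2 + q1 ^ 2 * l) - (2 * q0 * q1 + q1 ^ 2)"
  have TQ: "T * T - Q * Q * s = of_int u + of_int v * w"
    unfolding T_def Q_def sw u_def v_def of_int_add of_int_mult of_int_diff of_int_power of_int_numeral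
    by (rule quadratic_coordinates[OF ww])
  have "of_rat (of_int u / 4 + of_int v / 8) + of_rat (of_int v / 8) * s = of_int (m ^ 4) * (z * z')"
  proof -
    have "of_int (m ^ 4) * (z * z') = ((2 * of_int (m ^ 2) * p) * (2 * of_int (m ^ 2) * p)
        - (2 * of_int (m ^ 2) * q) * (2 * of_int (m ^ 2) * q) * (\<tau> * \<tau>)) / 4"
      by (simp add: zpq z'pq algebra_simps power2_eq_square power4_eq_xxxx)
    also have "\<dots> = (of_int u + of_int v * w) / 4"
      by (simp only: Tp[symmetric] Qq[symmetric] tt TQ)
    finally show ?thesis by (simp add: w_def of_rat_add of_rat_divide of_rat_mult field_simps)
  qed
  then have "algebraic_int (of_rat (of_int u / 4 + of_int v / 8) + of_rat (of_int v / 8) * s)"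
    using iz iz' by (simp only: algebraic_int_simps)
  from quadratic_integral[OF l this] obtain n0 n1 where
    n: "of_int m * (of_rat (of_int u / 4 + of_int v / 8) + of_rat (of_int v / 8) * s) = of_int n0 + of_int n1 * ((1 + s) / 2)"
    by blast
  have "of_rat (of_int (m * u) / 4 + of_int (m * v) / 8 - of_int n0 - of_int n1 / 2)
      + of_rat (of_int (m * v) / 8 - of_int n1 / 2) * s
    = of_int m * (of_rat (of_int u / 4 + of_int v / 8) + of_rat (of_int v / 8) * s)
      - (of_int n0 + of_int n1 * ((1 + s) / 2))"
    by (simp add: of_rat_add of_rat_diff of_rat_divide of_rat_mult field_simps)
  then have "of_rat (of_int (m * u) / 4 + of_int (m * v) / 8 - of_int n0 - of_int n1 / 2)
      + of_rat (of_int (m * v) / 8 - of_int n1 / 2) * s = 0"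
    using n by simp
  from sqrt_independent[OF this]
  have "of_int (m * v) = (of_int (4 * n1) :: rat)" "of_int (m * u) = (of_int (4 * n0) :: rat)"
    by (simp_all add: field_simps)
  then have "m * v = 4 * n1" "m * u = 4 * n0" by (simp_all only: of_int_eq_iff)
  then have "v = 4 * (n1 - l * v)" "u = 4 * (n0 - l * u)" using l by (simp_all add: algebra_simps)
  then obtain v' u' where v': "v = 4 * v'" and u': "u = 4 * u'" by blast
  \<comment> \<open>The order matters: \<open>v\<close> modulo 2 gives
    \<open>T1 \<equiv> q1\<close>; inserting this, \<open>u\<close> modulo 4 makes
    \<open>T0 ^ 2 + q0 ^ 2\<close> divisible by 4, so both are even; then \<open>v\<close> modulo 4
    yields the parity of \<open>q1 * l\<close>.\<close>
  have "T1 ^ 2 - q1 ^ 2 = 2 * (2 * v' - T0 * T1 + (q0 ^ 2 + q1 ^ 2 * l) + q0 * q1)"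
    using v' unfolding v_def by (simp add: algebra_simps)
  then have "even (T1 ^ 2 - q1 ^ 2)" by simp
  then have ev: "even (T1 - q1)" by simp
  then obtain r where r: "T1 = q1 + 2 * r" by (metis add.commute diff_add_cancel evenE)
  have eq: "T0 ^ 2 + q0 ^ 2 = 4 * (u' - l * (q1 * r + r ^ 2 - q0 * q1))"
    using u' unfolding u_def r by (simp add: power2_eq_square algebra_simps)
  have ev0: "even T0 \<and> even q0"
  proof -
    have "even (T0 ^ 2 + q0 ^ 2)" unfolding eq by simp
    then have par: "even T0 \<longleftrightarrow> even q0" by simp
    show ?thesis
    proof (rule ccontr)
      assume "\<not> (even T0 \<and> even q0)"
      then obtain a b where "T0 = 2 * a + 1" "q0 = 2 * b + 1" using par by (metis oddE)
      then have "T0 ^ 2 + q0 ^ 2 = 4 * (a ^ 2 + a + b ^ 2 + b) + 2"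
        by (simp add: power2_eq_square algebra_simps)
      then show False using eq by presburger
    qed
  qed
  then obtain a b where ab: "T0 = 2 * a" "q0 = 2 * b" by blast
  have "2 * (q1 ^ 2 * l) = 4 * (a * T1 + q1 * r + r ^ 2 - 2 * b ^ 2 - b * q1 - v')"
    using v' unfolding v_def ab r by (simp add: power2_eq_square algebra_simps)
  then have "q1 ^ 2 * l = 2 * (a * T1 + q1 * r + r ^ 2 - 2 * b ^ 2 - b * q1 - v')" by simp
  then have "even (q1 ^ 2 * l)" by simp
  then have ev1: "even (q1 * l)" by simp
  have "2 * of_int (m ^ 2) * rpoly Z \<tau> = T + Q * \<tau>"
    unfolding Z z_def[symmetric] zpq Tp Qq by (simp add: algebra_simps)
  then show ?thesis using ev0 ev ev1 unfolding T_def Q_def w_def by blast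
qed

text \<open>For even \<open>l\<close> the prime 2 splits in the quadratic field, and
  \<open>s\<close> is a square modulo 4 where \<open>w\<close> is a unit. There
  \<open>(1 + \<tau>) / 2\<close> becomes integral; the factor \<open>w\<close> removes its
  denominator at the other prime.\<close>

lemma frobenius2_gens:
  assumes l: "m = 4 * l + 1"
  shows "c \<in> frobenius2" "\<tau> \<in> frobenius2" "(1 + s) / 2 \<in> frobenius2"
    and "even l \<Longrightarrow> (1 + s) / 2 * ((1 + \<tau>) / 2) \<in> frobenius2"
proof -
  define w where "w = (1 + s) / 2"
  define L :: complex where "L = of_int l"
  have ss: "s * s = of_int m" using s_square by (simp add: power2_eq_square)
  have mL: "of_int m = 4 * L + 1" using l by (simp add: L_def)
  have ww: "w * w = w + L" using ss mL by (simp add: w_def field_simps)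
  have iw: "algebraic_int w"
  proof -
    have "ipoly [:- l, - 1, 1:] w = 0" using ww by (simp add: hom_distribs L_def algebra_simps)
    moreover have "lead_coeff [:- l, - 1, 1:] = 1" by simp
    ultimately show ?thesis unfolding algebraic_int_altdef_ipoly by blast
  qed
  have iL: "algebraic_int L" by (simp add: L_def)
  have sw: "s = 2 * w - 1" by (simp add: w_def)
  have "c ^ 8 = (c ^ 3) ^ 2 * c ^ 2" by (simp flip: power_mult power_add)
  then have "c ^ 8 = of_int (M ^ 2) * c ^ 2" unfolding c_cube by simp
  then have "c ^ 8 = (4 * L + 1) ^ 2 * c ^ 2"
    by (simp add: M_def power_mult_distrib mL)
  then have "(c ^ 8 - c ^ 2) / 2 = (8 * L ^ 2 + 4 * L) * c ^ 2"
    by (simp add: power2_eq_square algebra_simps)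
  then show "c \<in> frobenius2" using iL by (simp add: frobenius2_def)
  have "\<tau> ^ 8 = (\<tau> ^ 4) ^ 2" by (simp flip: power_mult)
  then have "\<tau> ^ 8 - \<tau> ^ 2 = 2 * (8 * L ^ 2 + 4 * L + 1 - w)"
    unfolding tau_four mL tau_square sw by (simp add: power2_eq_square algebra_simps)
  then have e: "(\<tau> ^ 8 - \<tau> ^ 2) / 2 = 8 * L ^ 2 + 4 * L + 1 - w" by simp
  show "\<tau> \<in> frobenius2" unfolding frobenius2_def mem_Collect_eq e using iL iw by simp
  have "even (l * (l + 1))" by simp
  then obtain e where "l * (l + 1) = 2 * e" by blast
  then have e: "L * (L + 1) = 2 * of_int e"
    unfolding L_def by (metis of_int_1 of_int_add of_int_mult of_int_numeral)
  define E :: complex where "E = of_int e"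
  have iE: "algebraic_int E" by (simp add: E_def)
  have w4: "w ^ 4 = (1 + 2 * L) * w + 2 * E" 
  proof -
    have "w ^ 4 = (w * w) * (w * w)" by (simp add: power4_eq_xxxx)
    also have "\<dots> = (w + L) * (w + L)" by (simp only: ww)
    also have "\<dots> = w * w + 2 * L * w + L * L" by (simp add: algebra_simps)
    also have "\<dots> = (1 + 2 * L) * w + L * (L + 1)" by (simp only: ww) (simp add: algebra_simps)
    finally show ?thesis by (simp add: e E_def)
  qed
  have "w ^ 8 = (w ^ 4) ^ 2" by (simp flip: power_mult)
  then have "w ^ 8 - w ^ 2 = 4 * (L * (L + 1)) * w ^ 2 + 4 * (1 + 2 * L) * E * w + 4 * E ^ 2"
    unfolding w4 by (simp add: algebra_simps power2_eq_square)
  then have "w ^ 8 - w ^ 2 = 2 * (4 * E * w ^ 2 + 2 * (1 + 2 * L) * E * w + 2 * E ^ 2)"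
    unfolding e E_def by (simp add: algebra_simps)
  then have eq: "(w ^ 8 - w ^ 2) / 2 = 4 * E * w ^ 2 + 2 * (1 + 2 * L) * E * w + 2 * E ^ 2" by simp
  show "(1 + s) / 2 \<in> frobenius2"
    unfolding w_def[symmetric] frobenius2_def mem_Collect_eq eq using iL iE iw by simp
  assume "even l"
  then obtain k where k: "l = 2 * k" by blast
  have "even (k * k - k)" by simp
  then obtain f where f: "k * k - k = 2 * f" by blast
  define \<kappa> F :: complex where "\<kappa> = of_int k" and "F = of_int f"
  have ik: "algebraic_int \<kappa>" "algebraic_int F" by (simp_all add: \<kappa>_def F_def)
  have F: "\<kappa> * \<kappa> - \<kappa> = 2 * F"
    unfolding \<kappa>_def F_def using f by (metis of_int_diff of_int_mult of_int_numeral)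
  have ww: "w * w = w + 2 * \<kappa>" using ww k by (simp add: L_def \<kappa>_def)
  define \<delta> where "\<delta> = w * ((1 + \<tau>) / 2)"
  have tt: "\<tau> * \<tau> = 2 * w - 1" using tau_square sw by (simp add: power2_eq_square)
  have "4 * (\<delta> * \<delta> - (w * \<delta> + \<kappa> * w))
      = w * w * (\<tau> * \<tau> - (2 * w - 1)) + 2 * w * (w * w - (w + 2 * \<kappa>))"
    by (simp add: \<delta>_def field_simps)
  also have "\<dots> = 0" unfolding tt ww by simp
  finally have d2: "\<delta> * \<delta> = w * \<delta> + \<kappa> * w" by (simp only: mult_eq_0_iff) simp
  \<comment> \<open>The right side multiplies the quadratic relation of \<open>\<delta>\<close> by
    its conjugate under \<open>w \<mapsto> 1 - w\<close>; this norm is the monic quartic witnessing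
    integrality.\<close>
  have "\<delta> ^ 4 - \<delta> ^ 3 - 3 * \<kappa> * \<delta> ^ 2 - 4 * \<kappa> ^ 2 * \<delta> - 2 * \<kappa> ^ 3
      = (\<delta> * \<delta> - (w * \<delta> + \<kappa> * w)) * (\<delta> ^ 2 - (1 - w) * \<delta> - \<kappa> * (1 - w))
        + (w * w - (w + 2 * \<kappa>)) * (\<delta> + \<kappa>) ^ 2"
    by (simp add: power2_eq_square power3_eq_cube power4_eq_xxxx algebra_simps)
  then have "\<delta> ^ 4 - \<delta> ^ 3 - 3 * \<kappa> * \<delta> ^ 2 - 4 * \<kappa> ^ 2 * \<delta> - 2 * \<kappa> ^ 3 = 0"
    by (simp add: d2 ww)
  then have "ipoly [:- 2 * k ^ 3, - 4 * k ^ 2, - 3 * k, - 1, 1:] \<delta> = 0"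
    by (simp add: hom_distribs \<kappa>_def power2_eq_square power3_eq_cube power4_eq_xxxx algebra_simps)
  moreover have "lead_coeff [:- 2 * k ^ 3, - 4 * k ^ 2, - 3 * k, - 1, 1:] = 1" by simp
  ultimately have id: "algebraic_int \<delta>" unfolding algebraic_int_altdef_ipoly by blast
  \<comment> \<open>\<open>V\<close> is half of \<open>\<delta> ^ 4 - w * \<delta>\<close>. So
    \<open>\<delta> ^ 8 \<equiv> (w * \<delta>) ^ 2\<close> modulo 2, and \<open>wwdd\<close> says
    that this is \<open>\<delta> ^ 2\<close>.\<close>
  define V where "V = \<kappa> * \<delta> ^ 2 + \<kappa> * w ^ 2 * \<delta> + F * w + \<kappa> ^ 3 + \<kappa> * \<delta> + \<kappa> ^ 2 + \<kappa> * w"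
  have wwdd: "(w * w) * (\<delta> * \<delta>) = w * \<delta> + \<kappa> * w + 2 * (\<kappa> * \<delta> + \<kappa> ^ 2 + \<kappa> * \<delta> ^ 2)"
  proof -
    have "(w * w) * (\<delta> * \<delta>) = w * (\<delta> * \<delta>) + 2 * \<kappa> * (\<delta> * \<delta>)" unfolding ww by (rule distrib_right)
    also have "w * (\<delta> * \<delta>) = (w * w) * (\<delta> + \<kappa>)" unfolding d2 by (simp add: algebra_simps)
    finally show ?thesis unfolding ww by (simp add: algebra_simps power2_eq_square)
  qed
  have kkww: "\<kappa> * \<kappa> * (w * w) = \<kappa> * w + 2 * F * w + 2 * \<kappa> ^ 3"
  proof -
    have "\<kappa> * \<kappa> * (w * w) = (\<kappa> * \<kappa> - \<kappa>) * w + \<kappa> * w + 2 * \<kappa> ^ 3"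
      unfolding ww by (simp add: algebra_simps power3_eq_cube)
    then show ?thesis unfolding F by simp
  qed
  have d4: "\<delta> ^ 4 = w * \<delta> + 2 * V"
  proof -
    have "\<delta> ^ 4 = (\<delta> * \<delta>) * (\<delta> * \<delta>)" by (simp add: power4_eq_xxxx)
    also have "\<dots> = (w * \<delta> + \<kappa> * w) * (w * \<delta> + \<kappa> * w)" by (simp only: d2)
    also have "\<dots> = (w * w) * (\<delta> * \<delta>) + 2 * \<kappa> * w ^ 2 * \<delta> + \<kappa> * \<kappa> * (w * w)"
      by (simp add: algebra_simps power2_eq_square)
    also have "\<dots> = w * \<delta> + 2 * V"
      unfolding wwdd kkww V_def by (simp add: algebra_simps)
    finally show ?thesis .
  qed
  have "\<delta> ^ 8 = (\<delta> ^ 4) ^ 2" by (simp flip: power_mult)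
  then have "\<delta> ^ 8 = (w * w) * (\<delta> * \<delta>) + 2 * (2 * w * \<delta> * V + 2 * V ^ 2)"
    unfolding d4 by (simp add: algebra_simps power2_eq_square)
  moreover have "\<delta> ^ 2 = w * \<delta> + \<kappa> * w" by (simp add: power2_eq_square d2)
  ultimately have "\<delta> ^ 8 - \<delta> ^ 2 = 2 * (\<kappa> * \<delta> + \<kappa> ^ 2 + \<kappa> * \<delta> ^ 2 + 2 * w * \<delta> * V + 2 * V ^ 2)"
    unfolding wwdd by (simp add: algebra_simps)
  then have eq: "(\<delta> ^ 8 - \<delta> ^ 2) / 2 = \<kappa> * \<delta> + \<kappa> ^ 2 + \<kappa> * \<delta> ^ 2 + 2 * w * \<delta> * V + 2 * V ^ 2" by simp
  have "algebraic_int V" unfolding V_def using ik iw id by simp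
  then show "(1 + s) / 2 * ((1 + \<tau>) / 2) \<in> frobenius2"
    unfolding w_def[symmetric] \<delta>_def[symmetric] frobenius2_def mem_Collect_eq eq using ik iw id by simp
qed

text \<open>If \<open>q1\<close> is even, everything can be halved in the span of 1,
  \<open>w\<close>, \<open>\<tau>\<close> and \<open>w * \<tau>\<close>. If \<open>q1\<close> is
  odd, then \<open>l\<close> is even and the leftover \<open>q1 * w * (1 + \<tau>)\<close> is twice
  a multiple of the extra generator.\<close>

lemma quartic_frobenius2:
  assumes l: "m = 4 * l + 1" and int: "algebraic_int (rpoly Z \<tau>)"
  shows "rpoly Z \<tau> \<in> frobenius2"
proof -
  define w where "w = (1 + s) / 2"
  note gens = frobenius2_gens[OF l, folded w_def]
  obtain t0 t1 q0 q1 where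
    eq: "2 * of_int (m ^ 2) * rpoly Z \<tau> = of_int t0 + of_int t1 * w + (of_int q0 + of_int q1 * w) * \<tau>"
    and even: "even t0" "even q0" "even (t1 - q1)" "even (q1 * l)"
    using quartic_integral[OF l int, folded w_def] by blast
  obtain a b r where abr: "t0 = 2 * a" "q0 = 2 * b" "t1 - q1 = 2 * r" using even by (metis evenE)
  have t1: "t1 = q1 + 2 * r" using abr by simp
  have "of_int (m ^ 2) * rpoly Z \<tau> \<in> frobenius2"
  proof (cases "even q1")
    case True
    then obtain e where e: "q1 = 2 * e" by blast
    have "2 * (of_int (m ^ 2) * rpoly Z \<tau>) = 2 * (of_int a + of_int (e + r) * w + (of_int b + of_int e * w) * \<tau>)"
      using eq unfolding abr t1 e by (simp add: algebra_simps)
    then have "of_int (m ^ 2) * rpoly Z \<tau> = of_int a + of_int (e + r) * w + (of_int b + of_int e * w) * \<tau>"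
      by (metis mult_cancel_left zero_neq_numeral)
    then show ?thesis using gens by (simp only: frobenius2_add frobenius2_mult frobenius2_of_int)
  next
    case False
    then have "even l" using even by simp
    have "2 * (of_int (m ^ 2) * rpoly Z \<tau>) = 2 * (of_int a + of_int r * w + of_int b * \<tau> + of_int q1 * (w * ((1 + \<tau>) / 2)))"
      using eq unfolding abr t1 by (simp add: field_simps)
    then have "of_int (m ^ 2) * rpoly Z \<tau> = of_int a + of_int r * w + of_int b * \<tau> + of_int q1 * (w * ((1 + \<tau>) / 2))"
      by (metis mult_cancel_left zero_neq_numeral)
    then show ?thesis using gens \<open>even l\<close> by (simp only: frobenius2_add frobenius2_mult frobenius2_of_int)
  qed
  moreover have "odd (m ^ 2)" using l by simp
  ultimately show ?thesis using frobenius2_odd_cancel int by blast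
qed

lemma integral_frobenius2:
  assumes l: "m = 4 * l + 1" and x: "x \<in> A"
  shows "x \<in> frobenius2"
proof -
  obtain Z0 Z1 Z2 where eq: "of_int (3 * M) * x = rpoly Z0 \<tau> + rpoly Z1 \<tau> * c + rpoly Z2 \<tau> * c ^ 2"
    and "algebraic_int (rpoly Z0 \<tau>)" "algebraic_int (rpoly Z1 \<tau>)" "algebraic_int (rpoly Z2 \<tau>)"
    using integral_decompose_cubic[OF x] by blast
  then have "of_int (3 * M) * x \<in> frobenius2"
    unfolding eq power2_eq_square
    by (intro frobenius2_add frobenius2_mult quartic_frobenius2[OF l] frobenius2_gens(1)[OF l])
  moreover have "odd (3 * M)" using l eps by (auto simp: M_def)
  moreover have "algebraic_int x" using x by (simp add: A_def)
  ultimately show ?thesis using frobenius2_odd_cancel[of "3 * M" x] by blast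
qed

end

context pure12_monogenic
begin

lemma not_1_mod_4: "m \<noteq> 4 * l + 1"
proof
  assume l: "m = 4 * l + 1"
  define Q :: "int poly" where "Q = Polynomial.monom 1 8 - Polynomial.monom 1 2"
  have "ipoly Q \<theta> = \<theta> ^ 8 - \<theta> ^ 2" by (simp add: Q_def hom_distribs)
  then have "algebraic_int (ipoly Q \<theta> / of_int 2)"
    using integral_frobenius2[OF l theta_A] by (simp add: frobenius2_def)
  moreover have "degree Q < 12"
    unfolding Q_def by (intro degree_diff_less) (auto simp: degree_monom_eq)
  ultimately obtain R where "Q = smult 2 R" using divisible_coeffs[of Q 2] by auto
  then have "coeff Q 8 = 2 * coeff R 8" by simp
  then show False by (simp add: Q_def) presburger
qed

end

subsection \<open>The prime 3\<close>

text \<open>The ideal generated by 3 and \<open>b\<close> among all algebraic integers;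
  \<open>b\<close> will be \<open>c - 1\<close>, and once
  \<open>\<theta> ^ 3 - \<theta>\<close>.\<close>

definition ideal3 :: "complex \<Rightarrow> complex set" where
  "ideal3 b = {3 * u + b * v |u v. algebraic_int u \<and> algebraic_int v}"

lemma ideal3I: "x = 3 * u + b * v \<Longrightarrow> algebraic_int u \<Longrightarrow> algebraic_int v \<Longrightarrow> x \<in> ideal3 b"
  unfolding ideal3_def by blast

lemma ideal3E:
  assumes "x \<in> ideal3 b"
  obtains u v where "x = 3 * u + b * v" "algebraic_int u" "algebraic_int v"
  using assms unfolding ideal3_def by blast

lemma ideal3_add: "x \<in> ideal3 b \<Longrightarrow> y \<in> ideal3 b \<Longrightarrow> x + y \<in> ideal3 b"
proof (elim ideal3E)
  fix u v u' v'
  assume "x = 3 * u + b * v" "algebraic_int u" "algebraic_int v"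
    "y = 3 * u' + b * v'" "algebraic_int u'" "algebraic_int v'"
  then show "x + y \<in> ideal3 b"
    by (intro ideal3I[of _ "u + u'" _ "v + v'"]) (simp_all add: algebra_simps)
qed

lemma ideal3_mult: "algebraic_int r \<Longrightarrow> x \<in> ideal3 b \<Longrightarrow> r * x \<in> ideal3 b"
proof (elim ideal3E)
  fix u v
  assume "algebraic_int r" "x = 3 * u + b * v" "algebraic_int u" "algebraic_int v"
  then show "r * x \<in> ideal3 b"
    by (intro ideal3I[of _ "r * u" _ "r * v"]) (simp_all add: algebra_simps)
qed

lemma ideal3_diff: "x \<in> ideal3 b \<Longrightarrow> y \<in> ideal3 b \<Longrightarrow> x - y \<in> ideal3 b"
  using ideal3_add[of x b "- 1 * y"] ideal3_mult[of "- 1" y b] by simp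

lemma ideal3_three: "algebraic_int u \<Longrightarrow> 3 * u \<in> ideal3 b"
  by (rule ideal3I[of _ u _ 0]) auto

lemma ideal3_gen: "algebraic_int v \<Longrightarrow> b * v \<in> ideal3 b"
  by (rule ideal3I[of _ 0 _ v]) auto

lemma ideal3_cancel:
  assumes "\<not> 3 dvd D" "of_int D * x \<in> ideal3 b" "algebraic_int x"
  shows "x \<in> ideal3 b"
proof -
  have "Rings.coprime D 3"
    using assms(1) prime_imp_coprime[of "3 :: int" D] by (simp add: coprime_commute)
  then obtain e f where "e * D + f * 3 = 1" using bezout_int[of D 3] by auto
  then have ef: "of_int e * of_int D + of_int f * 3 = (1 :: complex)"
    by (metis of_int_1 of_int_add of_int_mult of_int_numeral)
  have "x = (of_int e * of_int D + of_int f * 3) * x" by (simp only: ef mult_1)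
  also have "\<dots> = of_int e * (of_int D * x) + 3 * (of_int f * x)" by (simp add: algebra_simps)
  finally show ?thesis
    using assms(2,3) by (metis algebraic_int_simps(3,5) ideal3_add ideal3_mult ideal3_three)
qed

text \<open>The weight \<open>e\<close> restricts the Frobenius condition to the primes not
  containing \<open>e\<close>. The weight \<open>1 + s\<close> with \<open>q = 3\<close> selects
  residue fields with three elements; otherwise \<open>e\<close> is 1.\<close>

definition frobenius3 :: "nat \<Rightarrow> complex \<Rightarrow> complex \<Rightarrow> complex set" where
  "frobenius3 q e b = {x. algebraic_int x \<and> e * (x ^ q - x) \<in> ideal3 b}"

lemma frobenius3_add:
  assumes q: "q = 3 \<or> q = 9" and e: "algebraic_int e"
    and "x \<in> frobenius3 q e b" "y \<in> frobenius3 q e b"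
  shows "x + y \<in> frobenius3 q e b"
proof -
  have xy: "algebraic_int x" "algebraic_int y" using assms by (auto simp: frobenius3_def)
  have 3: "(x + y) ^ 3 - (x + y) = (x ^ 3 - x) + (y ^ 3 - y) + 3 * (x ^ 2 * y + x * y ^ 2)"
    by (simp add: eval_nat_numeral algebra_simps)
  have 9: "(x + y) ^ 9 - (x + y) = (x ^ 9 - x) + (y ^ 9 - y) + 3 * (3 * x ^ 8 * y + 12 * x ^ 7 * y ^ 2
     + 28 * x ^ 6 * y ^ 3 + 42 * x ^ 5 * y ^ 4 + 42 * x ^ 4 * y ^ 5 + 28 * x ^ 3 * y ^ 6 + 12 * x ^ 2 * y ^ 7 + 3 * x * y ^ 8)"
    by (simp add: eval_nat_numeral algebra_simps)
  have "\<exists>u. algebraic_int u \<and> (x + y) ^ q - (x + y) = (x ^ q - x) + (y ^ q - y) + 3 * u"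
    using q
  proof
    assume "q = 3"
    show ?thesis unfolding \<open>q = 3\<close> by (rule exI, rule conjI[OF _ 3]) (use xy in simp)
  next
    assume "q = 9"
    show ?thesis unfolding \<open>q = 9\<close> by (rule exI, rule conjI[OF _ 9]) (use xy in simp)
  qed
  then obtain u where u: "algebraic_int u" "(x + y) ^ q - (x + y) = (x ^ q - x) + (y ^ q - y) + 3 * u"
    by blast
  have "e * ((x + y) ^ q - (x + y)) = e * (x ^ q - x) + e * (y ^ q - y) + 3 * (e * u)"
    unfolding u(2) by (simp add: algebra_simps)
  then show ?thesis using assms u(1) by (simp add: frobenius3_def ideal3_add ideal3_three)
qed

lemma frobenius3_mult:
  assumes "x \<in> frobenius3 q e b" "y \<in> frobenius3 q e b"
  shows "x * y \<in> frobenius3 q e b"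
proof -
  have "e * ((x * y) ^ q - x * y) = x ^ q * (e * (y ^ q - y)) + y * (e * (x ^ q - x))"
    by (simp add: power_mult_distrib algebra_simps)
  then show ?thesis using assms by (simp add: frobenius3_def ideal3_add ideal3_mult)
qed

lemma three_dvd_power_diff:
  fixes n :: int
  assumes "q = 3 \<or> q = 9"
  shows "3 dvd n ^ q - n"
proof -
  have "n mod 3 = 0 \<or> n mod 3 = 1 \<or> n mod 3 = 2" by presburger
  then have "(n mod 3) ^ q mod 3 = n mod 3" using assms by auto
  then have "n ^ q mod 3 = n mod 3" by (simp add: power_mod)
  then show ?thesis by (simp add: mod_eq_dvd_iff)
qed

lemma power_diff_of_int:
  assumes "q = 3 \<or> q = 9"
  obtains z where "(of_int n :: complex) ^ q - of_int n = 3 * of_int z"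
proof -
  obtain z where "n ^ q - n = 3 * z" using three_dvd_power_diff[OF assms] by blast
  then have "(of_int n :: complex) ^ q - of_int n = 3 * of_int z"
    by (metis of_int_diff of_int_mult of_int_numeral of_int_power)
  then show ?thesis by (rule that)
qed

lemma frobenius3_of_int:
  assumes q: "q = 3 \<or> q = 9" and "algebraic_int e"
  shows "of_int n \<in> frobenius3 q e b"
proof -
  obtain z where z: "(of_int n :: complex) ^ q - of_int n = 3 * of_int z" by (rule power_diff_of_int[OF q])
  have "e * (3 * of_int z) = 3 * (e * of_int z)" by simp
  then show ?thesis unfolding frobenius3_def mem_Collect_eq z using assms
    by (metis algebraic_int_simps(3,5) ideal3_three)
qed

text \<open>\<open>D ^ q \<equiv> D\<close> modulo 3, so the condition for \<open>D * x\<close> is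
  \<open>D\<close> times that for \<open>x\<close>, and \<open>D\<close> is invertible modulo
  3.\<close>

lemma frobenius3_cancel:
  assumes q: "q = 3 \<or> q = 9" and e: "algebraic_int e" and x: "algebraic_int x"
    and D: "\<not> 3 dvd D" "of_int D * x \<in> frobenius3 q e b"
  shows "x \<in> frobenius3 q e b"
proof -
  obtain z where z: "(of_int D :: complex) ^ q - of_int D = 3 * of_int z" by (rule power_diff_of_int[OF q])
  have "of_int D * (e * (x ^ q - x)) = e * ((of_int D * x) ^ q - of_int D * x) - (of_int D ^ q - of_int D) * (e * x ^ q)"
    by (simp add: power_mult_distrib algebra_simps)
  also have "\<dots> = e * ((of_int D * x) ^ q - of_int D * x) - 3 * (of_int z * (e * x ^ q))"
    unfolding z by simp
  also have "\<dots> \<in> ideal3 b"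
    using D(2) e x by (intro ideal3_diff ideal3_three) (auto simp: frobenius3_def)
  finally have "e * (x ^ q - x) \<in> ideal3 b" using ideal3_cancel[OF D(1)] e x by simp
  then show ?thesis using x by (simp add: frobenius3_def)
qed

lemma frobenius3_ipoly:
  assumes "q = 3 \<or> q = 9" "algebraic_int e" "x \<in> frobenius3 q e b"
  shows "ipoly P x \<in> frobenius3 q e b"
proof (induction P)
  case 0
  show ?case using frobenius3_of_int[OF assms(1,2), of 0] by simp
next
  case (pCons a P)
  then show ?case
    using assms by (simp add: hom_distribs frobenius3_add frobenius3_mult frobenius3_of_int)
qed

lemma ipoly_minus_value:
  assumes "algebraic_int x"
  shows "\<exists>v. algebraic_int v \<and> ipoly P x - of_int (poly P a) = (x - of_int a) * v"
proof (induction P)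
  case 0
  show ?case by (intro exI[of _ 0]) simp
next
  case (pCons b P)
  then obtain v where v: "algebraic_int v" "ipoly P x - of_int (poly P a) = (x - of_int a) * v" by blast
  have "ipoly (pCons b P) x - of_int (poly (pCons b P) a)
      = (x - of_int a) * ipoly P x + of_int a * (ipoly P x - of_int (poly P a))"
    by (simp add: hom_distribs algebra_simps)
  also have "\<dots> = (x - of_int a) * (ipoly P x + of_int a * v)"
    unfolding v(2) by (simp add: algebra_simps)
  finally have "ipoly (pCons b P) x - of_int (poly (pCons b P) a) = (x - of_int a) * (ipoly P x + of_int a * v)" .
  moreover have "algebraic_int (ipoly P x + of_int a * v)"
    using v(1) algebraic_int_poly[OF assms] by simp
  ultimately show ?case by blast
qed

section \<open>The cubic field at 3\<close>

text \<open>\<open>\<gamma>\<close> is Dedekind's additional integer of a pure cubic field of the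
  second kind.\<close>

locale pure12_tower3 = pure12_tower +
  fixes k :: int and \<gamma> :: complex
  assumes M: "M = 9 * k + 1"
  defines "\<gamma> \<equiv> (1 + c + c ^ 2) / 3"
begin

text \<open>In the cubic field this is the product of the two primes above 3: modulo it
  \<open>c\<close> is 1 and \<open>\<gamma>\<close> is idempotent.\<close>

abbreviation J where "J \<equiv> ideal3 (c - 1)"

lemma ccc: "c * (c * c) = 9 * of_int k + 1"
  using c_cube by (simp add: M power3_eq_cube mult.assoc)

lemma c_gamma: "c * \<gamma> = \<gamma> + 3 * of_int k"
  using ccc by (simp add: \<gamma>_def power2_eq_square field_simps)

lemma gamma_square: "\<gamma> * \<gamma> = \<gamma> + 2 * of_int k + of_int k * c"
proof -
  have "3 * (\<gamma> * \<gamma>) = (1 + c + c ^ 2) * \<gamma>" by (simp add: \<gamma>_def)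
  also have "\<dots> = \<gamma> + c * \<gamma> + c * (c * \<gamma>)" by (simp add: algebra_simps power2_eq_square)
  also have "\<dots> = \<gamma> + (\<gamma> + 3 * of_int k) + (c * \<gamma> + 3 * of_int k * c)"
    unfolding c_gamma distrib_left by (simp add: c_gamma)
  also have "\<dots> = 3 * (\<gamma> + 2 * of_int k + of_int k * c)" unfolding c_gamma by (simp add: algebra_simps)
  finally show ?thesis by (simp only: mult_cancel_left) simp
qed

lemma gamma_cube: "\<gamma> ^ 3 = \<gamma> ^ 2 + 3 * of_int k * \<gamma> + 3 * of_int k ^ 2"
proof -
  have "\<gamma> ^ 3 = \<gamma> * (\<gamma> * \<gamma>)" by (simp add: power3_eq_cube)
  also have "\<dots> = \<gamma> * (\<gamma> + 2 * of_int k + of_int k * c)" by (simp only: gamma_square)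
  also have "\<dots> = \<gamma> * \<gamma> + 2 * of_int k * \<gamma> + of_int k * (c * \<gamma>)" by (simp add: algebra_simps)
  finally show ?thesis unfolding c_gamma by (simp add: algebra_simps power2_eq_square)
qed

lemma gamma_integral [simp]: "algebraic_int \<gamma>"
proof -
  have "ipoly [:- 3 * k ^ 2, - 3 * k, - 1, 1:] \<gamma> = 0"
    using gamma_cube by (simp add: hom_distribs algebra_simps power2_eq_square power3_eq_cube)
  moreover have "lead_coeff [:- 3 * k ^ 2, - 3 * k, - 1, 1:] = 1" by simp
  ultimately show ?thesis unfolding algebraic_int_altdef_ipoly by blast
qed

lemma nu_square: "(c - 1) * (c - 1) = 3 * (\<gamma> - c)"
  by (simp add: \<gamma>_def power2_eq_square algebra_simps)

lemma nu_gamma: "(c - 1) * \<gamma> = 3 * of_int k"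
  using c_gamma by (simp add: algebra_simps)

text \<open>Rests on \<open>(c - 1) * (c - 1) = 3 * (\<gamma> - c)\<close>: elements of
  \<open>J\<close> are nilpotent modulo 3.\<close>

lemma J_square:
  assumes "x \<in> J" "y \<in> J"
  shows "\<exists>u. algebraic_int u \<and> x * y = 3 * u"
proof -
  obtain a b where x: "x = 3 * a + (c - 1) * b" "algebraic_int a" "algebraic_int b" using assms(1) by (rule ideal3E)
  obtain d e where y: "y = 3 * d + (c - 1) * e" "algebraic_int d" "algebraic_int e" using assms(2) by (rule ideal3E)
  have "x * y = 3 * (3 * a * d + (c - 1) * (a * e + b * d)) + ((c - 1) * (c - 1)) * (b * e)"
    unfolding x(1) y(1) by (simp add: algebra_simps)
  also have "\<dots> = 3 * (3 * a * d + (c - 1) * (a * e + b * d) + (\<gamma> - c) * (b * e))"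
    unfolding nu_square by (simp add: algebra_simps)
  finally have eq: "x * y = 3 * (3 * a * d + (c - 1) * (a * e + b * d) + (\<gamma> - c) * (b * e))" .
  show ?thesis by (rule exI, rule conjI[OF _ eq]) (use x y in simp)
qed

text \<open>As \<open>(c - 1) * \<gamma> = 3 * k\<close>, the factor \<open>\<gamma>\<close> kills
  \<open>J\<close> modulo 3: it vanishes at the ramified prime and leaves the unramified
  one.\<close>

lemma gamma_J:
  assumes "x \<in> J"
  shows "\<exists>u. algebraic_int u \<and> \<gamma> ^ 2 * x = 3 * u"
proof -
  obtain a b where x: "x = 3 * a + (c - 1) * b" "algebraic_int a" "algebraic_int b" using assms by (rule ideal3E)
  have "\<gamma> ^ 2 * x = 3 * (\<gamma> ^ 2 * a) + ((c - 1) * \<gamma>) * (\<gamma> * b)"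
    unfolding x(1) by (simp add: algebra_simps power2_eq_square)
  also have "\<dots> = 3 * (\<gamma> ^ 2 * a + of_int k * (\<gamma> * b))" unfolding nu_gamma by (simp add: algebra_simps)
  finally have eq: "\<gamma> ^ 2 * x = 3 * (\<gamma> ^ 2 * a + of_int k * (\<gamma> * b))" .
  show ?thesis by (rule exI, rule conjI[OF _ eq]) (use x in simp)
qed

text \<open>In general \<open>\<gamma>\<close> is idempotent only modulo \<open>J\<close>, since
  \<open>\<gamma> * \<gamma> - \<gamma> = k * (c + 2)\<close>; squaring it absorbs this nilpotent
  error.\<close>

lemma gamma_idempotent: "\<gamma> ^ 2 * \<gamma> ^ 2 = \<gamma> ^ 2 + 3 * (of_int k * (\<gamma> + of_int k + \<gamma> ^ 2 + of_int k * \<gamma>))"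
proof -
  have "\<gamma> ^ 2 * \<gamma> ^ 2 = \<gamma> * \<gamma> ^ 3" by (simp add: power2_eq_square power3_eq_cube)
  also have "\<dots> = \<gamma> ^ 3 + 3 * of_int k * \<gamma> ^ 2 + 3 * of_int k ^ 2 * \<gamma>"
    by (subst gamma_cube) (simp add: algebra_simps power2_eq_square power3_eq_cube)
  also have "\<dots> = \<gamma> ^ 2 + 3 * (of_int k * (\<gamma> + of_int k + \<gamma> ^ 2 + of_int k * \<gamma>))"
    unfolding gamma_cube by (simp add: algebra_simps power2_eq_square)
  finally show ?thesis .
qed

lemma gamma_square_coords: "\<gamma> ^ 2 = (of_int (1 + 6 * k) + of_int (1 + 3 * k) * c + c ^ 2) / 3"
proof -
  have "\<gamma> ^ 2 = \<gamma> + 2 * of_int k + of_int k * c" by (simp add: power2_eq_square gamma_square)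
  also have "\<dots> = (of_int (1 + 6 * k) + of_int (1 + 3 * k) * c + c ^ 2) / 3"
    by (simp add: \<gamma>_def field_simps)
  finally show ?thesis .
qed

lemma not_three_dvd_M: "\<not> 3 dvd M" and not_three_dvd_m: "\<not> 3 dvd m"
proof -
  show "\<not> 3 dvd M" unfolding M by presburger
  then show "\<not> 3 dvd m" using dvd_mult[of 3 m \<epsilon>] by (auto simp: M_def)
qed

text \<open>Traces of \<open>y\<close>, \<open>c * y\<close> and \<open>c ^ 2 * y\<close> leave only
  the denominator 3; subtracting a multiple of \<open>\<gamma>\<close> removes the coordinate of
  \<open>c ^ 2\<close>, and the remaining \<open>(p + q * c) / 3\<close> is shown to have no
  denominator.\<close>

lemma cubic_integral:
  assumes "algebraic_int (rpoly Y c)"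
  shows "\<exists>a b d. of_int M * rpoly Y c = of_int a + of_int b * c + of_int d * \<gamma>"
proof -
  obtain a0 a1 a2 where Y: "rpoly Y c = rpoly [:a0, a1, a2:] c" using rpoly_c_cases by blast
  define y where "y = rpoly [:a0, a1, a2:] c"
  have y: "y = of_rat a0 + of_rat a1 * c + of_rat a2 * c ^ 2"
    by (simp add: y_def algebra_simps power2_eq_square)
  have iy: "algebraic_int y" using assms by (simp only: y_def Y)
  have trace: "\<exists>z. 3 * b0 = of_int z"
    if "algebraic_int (of_rat b0 + of_rat b1 * c + of_rat b2 * c ^ 2)" for b0 b1 b2
  proof -
    have "algebraic_int (rpoly [:b0:] \<tau> + rpoly [:b1:] \<tau> * c + rpoly [:b2:] \<tau> * c ^ 2)" using that by simp
    from trace_cubic_integral[OF this] have "algebraic_int (of_rat (3 * b0) :: complex)"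
      by (simp add: of_rat_mult)
    then show ?thesis by (metis algebraic_int_of_rat)
  qed
  have c3: "c * (c * c) = of_int M" "c * (c * (c * y)) = of_int M * y" for y
    unfolding c_cube[symmetric] by (simp_all add: power3_eq_cube mult.assoc)
  have "c * y = of_rat (a2 * of_int M) + of_rat a0 * c + of_rat a1 * c ^ 2"
    unfolding y by (simp add: c3 of_rat_mult algebra_simps power2_eq_square)
  moreover have "c ^ 2 * y = of_rat (a1 * of_int M) + of_rat (a2 * of_int M) * c + of_rat a0 * c ^ 2"
    unfolding y by (simp add: c3 of_rat_mult algebra_simps power2_eq_square)
  moreover have "algebraic_int (c * y)" "algebraic_int (c ^ 2 * y)" using iy by simp_all
  ultimately obtain A0 D0 B0 where ABD: "3 * a0 = of_int A0" "3 * (a2 * of_int M) = of_int D0" "3 * (a1 * of_int M) = of_int B0"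
    using trace[of a0 a1 a2] trace[of "a2 * of_int M" a0 a1] trace[of "a1 * of_int M" "a2 * of_int M" a0] iy y
    by metis
  define p q where "p = M * A0 - D0" and "q = B0 - D0"
  define v where "v = of_int M * y - of_int D0 * \<gamma>"
  have "3 * of_rat a0 = (of_int A0 :: complex)" "3 * (of_rat a2 * of_int M) = (of_int D0 :: complex)"
       "3 * (of_rat a1 * of_int M) = (of_int B0 :: complex)"
    using ABD by (metis of_rat_mult of_rat_numeral_eq of_rat_of_int_eq)+
  then have v: "v = (of_int p + of_int q * c) / 3"
    unfolding v_def y \<gamma>_def p_def q_def of_int_diff of_int_mult by (simp add: field_simps)
  have iv: "algebraic_int v" using iy by (simp add: v_def)
  \<comment> \<open>The trace of \<open>v\<close> itself gives nothing about \<open>p\<close>; that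
    of its square is \<open>p ^ 2 / 3\<close>.\<close>
  have "v ^ 2 = of_rat (of_int (p ^ 2) / 9) + of_rat (of_int (2 * p * q) / 9) * c + of_rat (of_int (q ^ 2) / 9) * c ^ 2"
    unfolding v by (simp add: of_rat_divide of_rat_mult of_rat_power power2_eq_square field_simps)
  moreover have "algebraic_int (v ^ 2)" using iv by simp
  ultimately obtain z where "3 * (of_int (p ^ 2) / 9) = (of_int z :: rat)" using trace by metis
  then have "(of_int (p ^ 2) :: rat) = of_int (3 * z)" by simp
  then have "p ^ 2 = 3 * z" by (simp only: of_int_eq_iff)
  then have "3 dvd p ^ 2" by simp
  then have "3 dvd p" by (rule prime_dvd_power[rotated]) simp
  then obtain p' where p': "p = 3 * p'" by blast
  \<comment> \<open>What is left is \<open>q * c / 3\<close>, whose cube is rational.\<close>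
  have "algebraic_int ((v - of_int p') ^ 3)" using iv by simp
  moreover have "(v - of_int p') ^ 3 = of_int (q ^ 3 * M) / of_int 27"
  proof -
    have e: "v - of_int p' = of_int q * c / 3" unfolding v p' by (simp add: add_divide_distrib)
    show ?thesis unfolding e by (simp add: power_mult_distrib power_divide c_cube)
  qed
  ultimately have "27 dvd q ^ 3 * M" using algebraic_int_of_int_divide_dvd[of "q ^ 3 * M" 27] by simp
  then have "3 dvd q ^ 3 * M" by (rule dvd_trans[rotated]) simp
  then have "3 dvd q ^ 3" using not_three_dvd_M prime_dvd_mult_iff[of "3 :: int"] by auto
  then have "3 dvd q" by (rule prime_dvd_power[rotated]) simp
  then obtain q' where q': "q = 3 * q'" by blast
  have "v = of_int p' + of_int q' * c" unfolding v p' q' by simp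
  then have "of_int M * rpoly Y c = of_int p' + of_int q' * c + of_int D0 * \<gamma>"
    unfolding Y y_def[symmetric] by (simp add: v_def algebra_simps)
  then show ?thesis by blast
qed

text \<open>\<open>x ^ 3 - x\<close> divides \<open>x ^ 9 - x\<close>, so \<open>q = 3\<close>
  decides both cases. Modulo \<open>J\<close>, \<open>c\<close> is 1 and \<open>\<gamma>\<close> is
  idempotent, hence both equal their cubes.\<close>

lemma frobenius3_gens:
  assumes q: "q = 3 \<or> q = 9" and e: "algebraic_int e"
  shows "c \<in> frobenius3 q e (c - 1)" "\<gamma> \<in> frobenius3 q e (c - 1)"
proof -
  have fac: "\<exists>v. algebraic_int v \<and> x ^ q - x = (x ^ 3 - x) * v" if "algebraic_int x" for x :: complex
  proof -
    have "x ^ 9 - x = (x ^ 3 - x) * (x ^ 6 + x ^ 4 + x ^ 2 + 1)"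
      by (simp add: eval_nat_numeral algebra_simps)
    then show ?thesis using q that by (metis algebraic_int_simps(1,4,6) mult_1_right)
  qed
  have reduce: "x \<in> frobenius3 q e (c - 1)" if x: "algebraic_int x" "x ^ 3 - x \<in> J" for x
  proof -
    obtain v where v: "algebraic_int v" "x ^ q - x = (x ^ 3 - x) * v" using fac x by blast
    have "e * (x ^ q - x) = (e * v) * (x ^ 3 - x)" unfolding v(2) by simp
    then have "e * (x ^ q - x) \<in> J" using ideal3_mult[OF _ x(2), of "e * v"] e v(1) by (simp only: algebraic_int_simps)
    then show ?thesis using x by (simp add: frobenius3_def)
  qed
  have "c ^ 3 - c = (c - 1) * (c * (c + 1))" by (simp add: power3_eq_cube algebra_simps)
  then show "c \<in> frobenius3 q e (c - 1)" using reduce ideal3_gen by simp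
  have "\<gamma> ^ 3 - \<gamma> = 3 * (of_int k + of_int k * \<gamma> + of_int k ^ 2) + (c - 1) * of_int k"
    unfolding gamma_cube power2_eq_square gamma_square by (simp add: algebra_simps)
  from ideal3I[OF this] have "\<gamma> ^ 3 - \<gamma> \<in> J" by simp
  then show "\<gamma> \<in> frobenius3 q e (c - 1)" using reduce by simp
qed

text \<open>The quartic field enters only through the condition on \<open>\<tau>\<close>; the
  denominators \<open>4 * m\<close> and \<open>M\<close> are invertible modulo 3.\<close>

lemma integral_frobenius3:
  assumes q: "q = 3 \<or> q = 9" and e: "algebraic_int e"
    and tau: "\<tau> \<in> frobenius3 q e (c - 1)" and x: "x \<in> A"
  shows "x \<in> frobenius3 q e (c - 1)"
proof -
  note closure = frobenius3_add[OF q e] frobenius3_mult frobenius3_of_int[OF q e] frobenius3_gens[OF q e] tau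
  have cubic: "rpoly Y c \<in> frobenius3 q e (c - 1)" if Y: "algebraic_int (rpoly Y c)" for Y
  proof (rule frobenius3_cancel[OF q e Y not_three_dvd_M])
    obtain a b d where "of_int M * rpoly Y c = of_int a + of_int b * c + of_int d * \<gamma>"
      using cubic_integral[OF Y] by blast
    then show "of_int M * rpoly Y c \<in> frobenius3 q e (c - 1)" by (simp only: closure)
  qed
  obtain Y0 Y1 Y2 Y3
    where eq: "of_int (4 * m) * x = rpoly Y0 c + rpoly Y1 c * \<tau> + rpoly Y2 c * \<tau> ^ 2 + rpoly Y3 c * \<tau> ^ 3"
    and "algebraic_int (rpoly Y0 c)" "algebraic_int (rpoly Y1 c)" "algebraic_int (rpoly Y2 c)" "algebraic_int (rpoly Y3 c)"
    using integral_decompose_quartic[OF x] by blast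
  then have "of_int (4 * m) * x \<in> frobenius3 q e (c - 1)"
    unfolding eq power2_eq_square power3_eq_cube by (intro closure cubic)
  moreover have "\<not> 3 dvd 4 * m" using not_three_dvd_m by presburger
  ultimately show ?thesis using frobenius3_cancel[OF q e] x by (auto simp: A_def)
qed

end

section \<open>Too few residues of a generator modulo 3\<close>

text \<open>By Gauss's lemma the constant \<open>p\<close> is a prime element of the integer
  polynomials, and it cannot divide a monic one.\<close>

lemma prime_dvd_monic_factor:
  fixes r H R :: "int poly"
  assumes p: "prime p" and H: "lead_coeff H = 1" and eq: "r * H = smult p R"
  shows "\<exists>r'. r = smult p r'"
proof -
  have "prime_elem [:p:]" using p prime_imp_prime_elem prime_elem_const_poly_iff by blast
  moreover have "[:p:] dvd r * H" unfolding eq by (rule dvdI[of _ _ R]) simp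
  ultimately have "[:p:] dvd r \<or> [:p:] dvd H" by (rule prime_elem_dvd_multD)
  moreover have "\<not> [:p:] dvd H"
  proof
    assume "[:p:] dvd H"
    then have "p dvd lead_coeff H" by (simp add: const_poly_dvd_iff)
    then show False using H p by (simp add: not_prime_unit)
  qed
  ultimately show ?thesis by (auto elim!: dvdE)
qed

locale pure12_monogenic3 = pure12_tower3 + pure12_monogenic
begin

text \<open>Where \<open>\<theta>\<close> takes values in the prime field, a residue of \<open>\<theta>\<close> determines the value of every
  element of \<open>\<int>[\<theta>]\<close>, so there is room for three orthogonal idempotents only.\<close>

lemma no_four_idempotents:
  fixes f :: "nat \<Rightarrow> complex"
  assumes f_A: "\<And>i. i < 4 \<Longrightarrow> f i \<in> A"
    and f_J: "\<And>i. i < 4 \<Longrightarrow> f i \<notin> J"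
    and idem: "\<And>i. i < 4 \<Longrightarrow> f i * f i - f i \<in> J"
    and orth: "\<And>i j. i < 4 \<Longrightarrow> j < 4 \<Longrightarrow> i \<noteq> j \<Longrightarrow> f i * f j \<in> J"
    and frob: "\<And>i. i < 4 \<Longrightarrow> f i * (\<theta> ^ 3 - \<theta>) \<in> J"
  shows False
proof -
  \<comment> \<open>Lagrange interpolation on the prime field: \<open>1 - (x - a) ^ 2\<close> is 1
    at \<open>a\<close> and 0 at the other two residues, so
    \<open>L 0 + L 1 + L 2 \<equiv> 1\<close> modulo 3.\<close>
  define L where "L = (\<lambda>a::int. 1 - (\<theta> - of_int a) ^ 2)"
  have intf: "algebraic_int (f i)" if "i < 4" for i using f_A[OF that] by (simp add: A_def)
  have intL: "algebraic_int (L a)" for a by (simp add: L_def)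
  have "\<exists>a\<in>{0, 1, 2}. f i * L a \<notin> J" if i: "i < (4::nat)" for i
  proof (rule ccontr)
    assume "\<not> ?thesis"
    then have "f i * L 0 + f i * L 1 + f i * L 2 \<in> J" by (simp add: ideal3_add)
    moreover have "3 * (f i * (1 + \<theta> ^ 2 - 2 * \<theta>)) \<in> J"
      using intf[OF i] by (intro ideal3_three) simp
    ultimately have "(f i * L 0 + f i * L 1 + f i * L 2) + 3 * (f i * (1 + \<theta> ^ 2 - 2 * \<theta>)) \<in> J"
      by (rule ideal3_add)
    also have "(f i * L 0 + f i * L 1 + f i * L 2) + 3 * (f i * (1 + \<theta> ^ 2 - 2 * \<theta>)) = f i"
      by (simp add: L_def power2_eq_square algebra_simps)
    finally show False using f_J[OF i] by blast
  qed
  then obtain a where a: "\<And>i. i < 4 \<Longrightarrow> a i \<in> {0, 1, 2 :: int}" "\<And>i. i < 4 \<Longrightarrow> f i * L (a i) \<notin> J"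
    by metis
  have "\<not> inj_on a {..<4}"
  proof
    assume "inj_on a {..<4}"
    then have "card (a ` {..<4}) = 4" by (simp add: card_image)
    moreover have "card (a ` {..<4}) \<le> card {0, 1, 2 :: int}" using a(1) by (intro card_mono) auto
    ultimately show False by simp
  qed
  then obtain i j where ij: "i < 4" "j < 4" "i \<noteq> j" "a i = a j" by (auto simp: inj_on_def)
  define b where "b = a j"
  \<comment> \<open>\<open>L b * (\<theta> - b)\<close> is
    \<open>(\<theta> - b) - (\<theta> - b) ^ 3\<close>, which is
    \<open>\<theta> - \<theta> ^ 3\<close> modulo 3 by Fermat's theorem for
    \<open>b\<close>.\<close>
  have fL: "f n * L b * (\<theta> - of_int b) \<in> J" if n: "n < 4" for n
  proof -
    obtain z where z: "(of_int b :: complex) ^ 3 - of_int b = 3 * of_int z" using power_diff_of_int[of 3 b] by blast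
    have "f n * L b * (\<theta> - of_int b) = f n * ((of_int b ^ 3 - of_int b) + 3 * (of_int b * \<theta> ^ 2 - of_int b ^ 2 * \<theta>)) - f n * (\<theta> ^ 3 - \<theta>)"
      by (simp add: L_def power2_eq_square power3_eq_cube algebra_simps)
    also have "\<dots> = 3 * (f n * (of_int z + (of_int b * \<theta> ^ 2 - of_int b ^ 2 * \<theta>))) - f n * (\<theta> ^ 3 - \<theta>)"
      unfolding z by (simp add: algebra_simps)
    also have "\<dots> \<in> J"
      using intf[OF n] frob[OF n] by (intro ideal3_diff ideal3_three) auto
    finally show ?thesis .
  qed
  obtain Q where Q: "f j = ipoly Q \<theta>" using generated f_A ij by blast
  obtain v where v: "algebraic_int v" "ipoly Q \<theta> - of_int (poly Q b) = (\<theta> - of_int b) * v"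
    using ipoly_minus_value[OF theta_integral] by blast
  define t where "t = poly Q b"
  have key: "f n * L b * f j - of_int t * (f n * L b) \<in> J" if n: "n < 4" for n
  proof -
    have "f n * L b * f j - of_int t * (f n * L b) = f n * L b * (ipoly Q \<theta> - of_int (poly Q b))"
      by (simp add: Q t_def algebra_simps)
    also have "\<dots> = v * (f n * L b * (\<theta> - of_int b))" unfolding v(2) by simp
    finally show ?thesis using fL[OF n] v(1) by (simp add: ideal3_mult)
  qed
  \<comment> \<open>By \<open>key\<close>, \<open>f j\<close> acts on \<open>f n * L b\<close>
    modulo \<open>J\<close> as the integer \<open>t\<close>. For \<open>n = i\<close> orthogonality
    makes this zero, so 3 divides \<open>t\<close>; for \<open>n = j\<close> idempotence makes it
    the identity, so \<open>f j * L b\<close> would lie in \<open>J\<close>.\<close>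
  have "3 dvd t"
  proof (rule ccontr)
    assume t: "\<not> 3 dvd t"
    have "L b * (f i * f j) - (f i * L b * f j - of_int t * (f i * L b)) \<in> J"
      by (rule ideal3_diff[OF ideal3_mult[OF intL orth[OF ij(1-3)]] key[OF ij(1)]])
    also have "L b * (f i * f j) - (f i * L b * f j - of_int t * (f i * L b)) = of_int t * (f i * L b)"
      by simp
    finally have "f i * L b \<in> J" using ideal3_cancel[OF t] intf intL ij by simp
    then show False using a(2)[OF ij(1)] ij(4) by (simp add: b_def)
  qed
  then obtain t' where t': "t = 3 * t'" by blast
  have "(f j * L b * f j - of_int t * (f j * L b)) - L b * (f j * f j - f j) + 3 * (of_int t' * (f j * L b)) \<in> J"
    by (rule ideal3_add[OF ideal3_diff[OF key[OF ij(2)] ideal3_mult[OF intL idem[OF ij(2)]]] ideal3_three])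
      (use intf[OF ij(2)] intL in simp)
  also have "(f j * L b * f j - of_int t * (f j * L b)) - L b * (f j * f j - f j) + 3 * (of_int t' * (f j * L b)) = f j * L b"
    by (simp add: t' algebra_simps)
  finally show False using a(2) ij by (simp add: b_def)
qed

text \<open>Modulo 3 the elements \<open>(1 + s) * (1 \<plusminus> \<tau>)\<close> are orthogonal idempotents, and so are \<open>\<gamma>\<^sup>2\<close> and
  \<open>1 - \<gamma>\<^sup>2\<close>; their four products are nonzero because their traces are not divisible by 3.\<close>

lemma not_monogenic_eps_1:
  assumes eps: "\<epsilon> = 1"
  shows False
proof -
  have mk: "of_int m = (9 * of_int k + 1 :: complex)" using M eps by (simp add: M_def)
  have ss: "s * s = 9 * of_int k + 1" using s_square mk by (simp add: power2_eq_square)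
  have tt: "\<tau> * \<tau> = s" using tau_square by (simp add: power2_eq_square)
  \<comment> \<open>The weight discards the primes with \<open>\<tau> ^ 2 \<equiv> -1\<close>, where
    the residue of \<open>\<tau>\<close> is not in the prime field.\<close>
  have "\<tau> \<in> frobenius3 3 (1 + s) (c - 1)"
  proof -
    have t3: "\<tau> ^ 3 = s * \<tau>" by (simp add: power3_eq_cube tt)
    have "(1 + s) * (\<tau> ^ 3 - \<tau>) = \<tau> * (s * s - 1)"
      unfolding t3 by (simp add: algebra_simps)
    also have "\<dots> = 3 * (3 * of_int k * \<tau>)" unfolding ss by simp
    finally have eq: "(1 + s) * (\<tau> ^ 3 - \<tau>) = 3 * (3 * of_int k * \<tau>)" .
    show ?thesis unfolding frobenius3_def mem_Collect_eq eq by (intro conjI ideal3_three) simp_all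
  qed
  from integral_frobenius3[OF _ _ this theta_A] have theta: "(1 + s) * (\<theta> ^ 3 - \<theta>) \<in> J"
    by (simp add: frobenius3_def)
  define a where "a = (\<lambda>\<sigma>. (1 + s) * (1 + \<sigma> * \<tau>))"
  define g where "g = (\<lambda>b. if b then \<gamma> ^ 2 else 1 - \<gamma> ^ 2)"
  have KA: "a \<sigma> * g b \<in> A" if "\<sigma> = 1 \<or> \<sigma> = - 1" for \<sigma> b
  proof -
    have "- 1 * \<tau> \<in> K" using K_ring(3)[OF K_ring(5)[of "- 1"] K_gens(2)] by simp
    then have "a \<sigma> \<in> K" using that unfolding a_def by (metis K_gens(2,3) K_ring(1,3,6) mult_1)
    moreover have "\<gamma> \<in> K" unfolding \<gamma>_def using K_divide_int[of "1 + c + c ^ 2" 3] by (simp add: K_ring K_gens)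
    then have "g b \<in> K" by (simp add: g_def K_ring)
    ultimately have "a \<sigma> * g b \<in> K" by (rule K_ring)
    moreover have "algebraic_int (a \<sigma>)" using that by (auto simp: a_def)
    moreover have "algebraic_int (g b)" by (simp add: g_def)
    ultimately show ?thesis by (simp add: A_def)
  qed
  have ia: "algebraic_int (a \<sigma>)" if "\<sigma> = 1 \<or> \<sigma> = - 1" for \<sigma> using that by (auto simp: a_def)
  have ig: "algebraic_int (g b)" for b by (simp add: g_def)
  have a_idem: "\<exists>u. algebraic_int u \<and> a \<sigma> * a \<sigma> = a \<sigma> + 3 * u" if \<sigma>: "\<sigma> = 1 \<or> \<sigma> = - 1" for \<sigma>
  proof -
    have \<sigma>2: "\<sigma> * \<sigma> = 1" using \<sigma> by auto
    have "a \<sigma> * a \<sigma> = (1 + 2 * s + s * s) * (1 + 2 * \<sigma> * \<tau> + (\<sigma> * \<sigma>) * (\<tau> * \<tau>))"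
      by (simp add: a_def algebra_simps)
    also have "\<dots> = (2 + 2 * s + 9 * of_int k) * (1 + 2 * \<sigma> * \<tau> + s)" unfolding ss \<sigma>2 tt by (simp add: algebra_simps)
    also have "\<dots> = 2 * (1 + 2 * s + s * s) + 4 * (1 + s) * \<sigma> * \<tau> + 9 * of_int k * (1 + 2 * \<sigma> * \<tau> + s)"
      by (simp add: algebra_simps)
    also have "\<dots> = a \<sigma> + 3 * (a \<sigma> + 6 * of_int k + 3 * of_int k * (1 + 2 * \<sigma> * \<tau> + s))"
      unfolding ss by (simp add: a_def algebra_simps)
    finally have eq: "a \<sigma> * a \<sigma> = a \<sigma> + 3 * (a \<sigma> + 6 * of_int k + 3 * of_int k * (1 + 2 * \<sigma> * \<tau> + s))" .
    have "algebraic_int \<sigma>" using \<sigma> by auto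
    then show ?thesis by - (rule exI, rule conjI[OF _ eq], use ia[OF \<sigma>] in simp)
  qed
  have a_orth: "a 1 * a (- 1) = 3 * (- 3 * of_int k * (1 + s))"
  proof -
    have "a 1 * a (- 1) = (1 + s) * ((1 + s) * (1 - \<tau> * \<tau>))" by (simp add: a_def algebra_simps)
    also have "\<dots> = (1 + s) * (1 - s * s)" unfolding tt by (simp add: algebra_simps)
    finally show ?thesis unfolding ss by (simp add: algebra_simps)
  qed
  obtain w where w: "algebraic_int w" "\<gamma> ^ 2 * \<gamma> ^ 2 = \<gamma> ^ 2 + 3 * w"
    using gamma_idempotent by (metis algebraic_int_simps(1,3,4,5) gamma_integral)
  have g_idem: "g b * g b = g b + 3 * w" for b
  proof (cases b)
    case True
    then show ?thesis using w by (simp add: g_def)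
  next
    case False
    have "g b * g b = 1 - 2 * \<gamma> ^ 2 + \<gamma> ^ 2 * \<gamma> ^ 2" using False by (simp add: g_def algebra_simps)
    then show ?thesis unfolding w(2) using False by (simp add: g_def algebra_simps)
  qed
  have g_orth: "g True * g False = 3 * (- w)"
  proof -
    have "g True * g False = \<gamma> ^ 2 - \<gamma> ^ 2 * \<gamma> ^ 2" by (simp add: g_def algebra_simps)
    then show ?thesis unfolding w(2) by simp
  qed
  have g_coords: "\<exists>g0 g1 g2::int. g b = (of_int g0 + of_int g1 * c + of_int g2 * c ^ 2) / 3 \<and> \<not> 3 dvd g0" for b
  proof (cases b)
    case True
    have "\<not> 3 dvd 1 + 6 * k" by presburger
    then show ?thesis
      using True gamma_square_coords by (intro exI[of _ "1 + 6 * k"] exI[of _ "1 + 3 * k"] exI[of _ 1]) (simp add: g_def)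
  next
    case False
    have "\<not> 3 dvd 2 - 6 * k" by presburger
    moreover have "g b = (of_int (2 - 6 * k) + of_int (- 1 - 3 * k) * c + of_int (- 1) * c ^ 2) / 3"
      using False gamma_square_coords by (simp add: g_def field_simps)
    ultimately show ?thesis by blast
  qed
  have idem: "\<exists>u. algebraic_int u \<and> (a \<sigma> * g b) * (a \<sigma> * g b) = a \<sigma> * g b + 3 * u"
    if \<sigma>: "\<sigma> = 1 \<or> \<sigma> = - 1" for \<sigma> b
  proof -
    obtain u where u: "algebraic_int u" "a \<sigma> * a \<sigma> = a \<sigma> + 3 * u" using a_idem[OF \<sigma>] by blast
    have "(a \<sigma> * g b) * (a \<sigma> * g b) = (a \<sigma> * a \<sigma>) * (g b * g b)" by (simp add: algebra_simps)
    also have "\<dots> = a \<sigma> * g b + 3 * (u * g b + a \<sigma> * w + 3 * u * w)"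
      unfolding u(2) g_idem by (simp add: algebra_simps)
    finally have eq: "(a \<sigma> * g b) * (a \<sigma> * g b) = a \<sigma> * g b + 3 * (u * g b + a \<sigma> * w + 3 * u * w)" .
    show ?thesis by (rule exI, rule conjI[OF _ eq]) (use ia[OF \<sigma>] ig w(1) u(1) in simp)
  qed
  \<comment> \<open>Membership in \<open>J\<close> makes the square divisible by 3, and idempotence
    modulo 3 then makes the element itself divisible by 3.\<close>
  have not_J: "a \<sigma> * g b \<notin> J" if \<sigma>: "\<sigma> = 1 \<or> \<sigma> = - 1" for \<sigma> b
  proof
    assume "a \<sigma> * g b \<in> J"
    then obtain u where u: "algebraic_int u" "(a \<sigma> * g b) * (a \<sigma> * g b) = 3 * u" using J_square by blast
    obtain u' where u': "algebraic_int u'" "(a \<sigma> * g b) * (a \<sigma> * g b) = a \<sigma> * g b + 3 * u'"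
      using idem[OF \<sigma>] by blast
    have "a \<sigma> * g b = 3 * u - 3 * u'" unfolding u(2)[symmetric] u'(2) by simp
    then have eq: "a \<sigma> * g b / 3 = u - u'" by (simp only: diff_divide_distrib) simp
    have int: "algebraic_int (a \<sigma> * g b / 3)" unfolding eq using u(1) u'(1) by simp
    obtain g0 g1 g2 where g: "g b = (of_int g0 + of_int g1 * c + of_int g2 * c ^ 2) / 3" "\<not> 3 dvd g0"
      using g_coords by blast
    obtain e :: int where e: "\<sigma> = of_int e" using \<sigma> by (metis of_int_1 of_int_minus)
    \<comment> \<open>One 3 of the denominator comes from \<open>g b\<close>, the other from the
      division by 3.\<close>
    define Z where "Z = (\<lambda>n::int. [:of_int n / 9, of_int (e * n) / 9, of_int n / 9, of_int (e * n) / 9 :: rat:])"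
    have Z: "rpoly (Z n) \<tau> = a \<sigma> * of_int n / 9" for n
    proof -
      have "rpoly (Z n) \<tau> = (1 + \<tau> * \<tau>) * (1 + of_int e * \<tau>) * of_int n / 9"
        by (simp add: Z_def of_rat_divide of_rat_mult field_simps)
      then show ?thesis unfolding tt by (simp add: a_def e)
    qed
    have "a \<sigma> * g b / 3 = rpoly (Z g0) \<tau> + rpoly (Z g1) \<tau> * c + rpoly (Z g2) \<tau> * c ^ 2"
      unfolding Z g(1) by (simp add: field_simps)
    with int have tr: "algebraic_int (rpoly (Z g0) \<tau> + rpoly (Z g1) \<tau> * c + rpoly (Z g2) \<tau> * c ^ 2)"
      by (simp only:)
    have "Z g0 = [:of_int g0 / 9, of_int (e * g0) / 9, of_int g0 / 9, of_int (e * g0) / 9:]"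
      by (simp only: Z_def)
    from trace_integral[OF tr this] obtain z where "12 * (of_int g0 / 9 :: rat) = of_int z" by blast
    then have "(of_int (4 * g0) :: rat) = of_int (3 * z)" by (simp add: field_simps)
    then have "4 * g0 = 3 * z" by (simp only: of_int_eq_iff)
    then show False using g(2) by presburger
  qed
  define f where "f = (\<lambda>n::nat. a (if n < 2 then 1 else - 1) * g (even n))"
  have sgn: "(if n < 2 then 1 else - 1 :: complex) = 1 \<or> (if n < 2 then 1 else - 1 :: complex) = - 1" for n :: nat
    by simp
  show False
  proof (rule no_four_idempotents[of f])
    show "f i \<in> A" for i unfolding f_def by (rule KA[OF sgn])
    show "f i \<notin> J" for i unfolding f_def by (rule not_J[OF sgn])
    show "f i * f i - f i \<in> J" for i
    proof -
      obtain u where "algebraic_int u" "f i * f i = f i + 3 * u" using idem[OF sgn] unfolding f_def by blast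
      then show ?thesis using ideal3_three[of u] by simp
    qed
    show "f i * (\<theta> ^ 3 - \<theta>) \<in> J" for i
    proof -
      define h where "h = (1 + (if i < 2 then 1 else - 1) * \<tau>) * g (even i)"
      have "f i * (\<theta> ^ 3 - \<theta>) = h * ((1 + s) * (\<theta> ^ 3 - \<theta>))"
        unfolding f_def a_def h_def by (simp only: mult_ac)
      moreover have "algebraic_int h" using ig by (simp add: h_def)
      ultimately show ?thesis using ideal3_mult[OF _ theta, of h] by (simp only:)
    qed
    show "f i * f j \<in> J" if ij: "i < 4" "j < 4" "i \<noteq> j" for i j
    proof -
      have "(i < 2) \<noteq> (j < 2) \<or> even i \<noteq> even j" using ij by presburger
      then consider "(i < 2) \<noteq> (j < 2)" | "even i \<noteq> even j" by blast
      then show ?thesis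
      proof cases
        case 1
        then have "f i * f j = g (even i) * g (even j) * (a 1 * a (- 1))" by (auto simp: f_def mult_ac)
        also have "\<dots> \<in> J" unfolding a_orth using ig by (intro ideal3_mult ideal3_three) auto
        finally show ?thesis .
      next
        case 2
        then have "f i * f j = a (if i < 2 then 1 else - 1) * a (if j < 2 then 1 else - 1) * (g True * g False)"
          by (cases "even i") (auto simp: f_def mult_ac)
        also have "\<dots> \<in> J" unfolding g_orth using ia w(1) by (intro ideal3_mult ideal3_three) auto
        finally show ?thesis .
      qed
    qed
  qed
qed

text \<open>With \<open>h = X\<^sup>6 + X\<^sup>4 + X\<^sup>2 + 1\<close>, the product of the three irreducible quadratics over the field
  with three elements, \<open>h(\<theta>)\<^sup>2\<close> and \<open>\<gamma>\<^sup>2 * h(\<theta>)\<close> vanish modulo 3. As \<open>h\<^sup>2\<close> is monic of degree 12,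
  \<open>\<gamma>\<^sup>2\<close> is then a multiple of \<open>h(\<theta>)\<close>, so that the idempotent \<open>\<gamma>\<^sup>2\<close> squares to zero.\<close>

lemma not_monogenic_eps_minus_1:
  assumes eps: "\<epsilon> = - 1"
  shows False
proof -
  have mk: "m = - (9 * k + 1)" using M eps by (simp add: M_def)
  have ss: "s * s = of_int m" using s_square by (simp add: power2_eq_square)
  have tt: "\<tau> * \<tau> = s" using tau_square by (simp add: power2_eq_square)
  have "\<tau> \<in> frobenius3 9 1 (c - 1)"
  proof -
    have "\<tau> ^ 9 = \<tau> ^ 4 * \<tau> ^ 4 * \<tau>" by (simp flip: power_add power_Suc2)
    then have "\<tau> ^ 9 - \<tau> = 3 * (of_int (27 * k ^ 2 + 6 * k) * \<tau>)"
      unfolding tau_four mk by (simp add: algebra_simps power2_eq_square)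
    then show ?thesis by (simp only: frobenius3_def mem_Collect_eq mult_1 ideal3_three algebraic_int_simps integral_gens)
  qed
  from integral_frobenius3[OF _ _ this theta_A] have theta9: "\<theta> ^ 9 - \<theta> \<in> J"
    by (simp add: frobenius3_def)
  define h where "h = \<theta> ^ 6 + \<theta> ^ 4 + \<theta> ^ 2 + 1"
  have ih: "algebraic_int h" by (simp add: h_def)
  have fac: "(\<theta> ^ 3 - \<theta>) * h = \<theta> ^ 9 - \<theta>" by (simp add: h_def eval_nat_numeral algebra_simps)
  have "\<tau> \<in> A" using K_gens by (simp add: A_def)
  then obtain P where "\<tau> = ipoly P \<theta>" using generated by blast
  \<comment> \<open>Holds trivially for this choice of ideal. Since \<open>\<tau>\<close> is a
    polynomial in \<open>\<theta>\<close>, \<open>\<tau> ^ 3 - \<tau>\<close> then lies in the ideal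
    of 3 and \<open>\<theta> ^ 3 - \<theta>\<close>.\<close>
  moreover have "\<theta> \<in> frobenius3 3 1 (\<theta> ^ 3 - \<theta>)"
    using ideal3_gen[of 1 "\<theta> ^ 3 - \<theta>"] by (simp add: frobenius3_def)
  ultimately have "\<tau> \<in> frobenius3 3 1 (\<theta> ^ 3 - \<theta>)" using frobenius3_ipoly by simp
  then obtain u v where uv: "\<tau> ^ 3 - \<tau> = 3 * u + (\<theta> ^ 3 - \<theta>) * v" "algebraic_int u" "algebraic_int v"
    by (auto simp: frobenius3_def elim: ideal3E)
  \<comment> \<open>An inverse of \<open>\<tau> ^ 3 - \<tau>\<close> modulo 3 up to an integer: the
    product is \<open>m * (m - 1) \<equiv> 2\<close>. Thus \<open>\<theta> ^ 3 - \<theta>\<close> is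
    also a unit modulo 3, and \<open>h\<close> inherits membership in \<open>J\<close> from
    \<open>\<theta> ^ 9 - \<theta>\<close>.\<close>
  define y where "y = \<tau> ^ 3 * (s + 1)"
  have iy: "algebraic_int y" by (simp add: y_def)
  have "(\<tau> ^ 3 - \<tau>) * y = \<tau> ^ 4 * (\<tau> * \<tau> - 1) * (s + 1)"
    by (simp add: y_def power3_eq_cube power4_eq_xxxx algebra_simps)
  also have "\<dots> = of_int m * (s * s - 1)" unfolding tau_four tt by (simp add: algebra_simps)
  also have "\<dots> = of_int (m * (m - 1))" unfolding ss by simp
  finally have unit: "(\<tau> ^ 3 - \<tau>) * y = of_int (m * (m - 1))" .
  have hJ: "h \<in> J"
  proof (rule ideal3_cancel[of "m * (m - 1)"])
    have "m * (m - 1) = 3 * (27 * k ^ 2 + 9 * k) + 2" by (simp add: mk power2_eq_square algebra_simps)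
    then show "\<not> 3 dvd m * (m - 1)" by presburger
    have "of_int (m * (m - 1)) * h = 3 * (u * y * h) + (v * y) * ((\<theta> ^ 3 - \<theta>) * h)"
      unfolding unit[symmetric] uv(1) by (simp add: algebra_simps)
    also have "\<dots> \<in> J" unfolding fac using theta9 uv iy ih by (intro ideal3_add ideal3_three ideal3_mult) auto
    finally show "of_int (m * (m - 1)) * h \<in> J" .
  qed (rule ih)
  obtain h2 where h2: "algebraic_int h2" "h * h = 3 * h2" using J_square[OF hJ hJ] by blast
  obtain gh where gh: "algebraic_int gh" "\<gamma> ^ 2 * h = 3 * gh" using gamma_J[OF hJ] by blast
  define H :: "int poly" where "H = [:1, 0, 1, 0, 1, 0, 1:]"
  have H: "ipoly H \<theta> = h" by (simp add: H_def h_def hom_distribs eval_nat_numeral algebra_simps)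
  have lcH: "lead_coeff H = 1" and degH: "degree H = 6" by (simp_all add: H_def)
  have "\<gamma> \<in> K" unfolding \<gamma>_def using K_divide_int[of "1 + c + c ^ 2" 3] by (simp add: K_ring K_gens)
  then have "\<gamma> ^ 2 \<in> A" by (simp add: A_def K_ring)
  then obtain G where G: "\<gamma> ^ 2 = ipoly G \<theta>" using generated by blast
  obtain q r where qr: "G = H * q + r" "r = 0 \<or> degree r < degree H"
    using monic_int_division[OF lcH] by blast
  define q\<theta> where "q\<theta> = ipoly q \<theta>"
  have iq: "algebraic_int q\<theta>" by (simp add: q\<theta>_def algebraic_int_poly)
  have Gqr: "\<gamma> ^ 2 = h * q\<theta> + ipoly r \<theta>" unfolding G qr(1) by (simp add: H q\<theta>_def)
  \<comment> \<open>Both terms on the right vanish modulo 3, while \<open>r * H\<close> has degree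
    at most 11; so \<open>r\<close> itself must vanish modulo 3.\<close>
  have "ipoly (r * H) \<theta> = \<gamma> ^ 2 * h - (h * h) * q\<theta>" unfolding Gqr ipoly_simps H by (simp add: algebra_simps)
  also have "\<dots> = 3 * (gh - h2 * q\<theta>)" unfolding gh(2) h2(2) by (simp add: algebra_simps)
  finally have "algebraic_int (ipoly (r * H) \<theta> / of_int 3)" using gh(1) h2(1) iq by simp
  moreover have "degree (r * H) < 12"
    using qr(2) degH degree_mult_le[of r H] by auto
  ultimately obtain R where "r * H = smult 3 R" using divisible_coeffs[of "r * H" 3] by auto
  then obtain r' where r': "r = smult 3 r'" using prime_dvd_monic_factor[of 3 H r R] lcH by auto
  define r\<theta> where "r\<theta> = ipoly r' \<theta>"
  have ir: "algebraic_int r\<theta>" by (simp add: r\<theta>_def algebraic_int_poly)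
  have G2: "\<gamma> ^ 2 = h * q\<theta> + 3 * r\<theta>" using Gqr unfolding r' ipoly_simps r\<theta>_def by simp
  obtain w where w: "algebraic_int w" "\<gamma> ^ 2 * \<gamma> ^ 2 = \<gamma> ^ 2 + 3 * w"
    using gamma_idempotent by (metis algebraic_int_simps(1,3,4,5) gamma_integral)
  have "\<gamma> ^ 2 * \<gamma> ^ 2 = (h * h) * (q\<theta> * q\<theta>) + 3 * (2 * h * q\<theta> * r\<theta> + 3 * r\<theta> * r\<theta>)"
    unfolding G2 by (simp add: algebra_simps)
  then have eq: "\<gamma> ^ 2 / 3 = h2 * (q\<theta> * q\<theta>) + (2 * h * q\<theta> * r\<theta> + 3 * r\<theta> * r\<theta>) - w"
    unfolding w(2) h2(2) by (simp add: field_simps)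
  have int: "algebraic_int (\<gamma> ^ 2 / 3)" unfolding eq using h2 iq ih ir w by simp
  \<comment> \<open>The trace of \<open>\<gamma> ^ 2 / 3\<close> is
    \<open>12 * (1 + 6 * k) / 9\<close>, never an integer.\<close>
  have "\<gamma> ^ 2 / 3 = rpoly [:of_int (1 + 6 * k) / 9:] \<tau> + rpoly [:of_int (1 + 3 * k) / 9:] \<tau> * c + rpoly [:1 / 9:] \<tau> * c ^ 2"
    unfolding gamma_square_coords by (simp add: of_rat_divide of_rat_add of_rat_mult field_simps)
  with int have tr: "algebraic_int (rpoly [:of_int (1 + 6 * k) / 9:] \<tau> + rpoly [:of_int (1 + 3 * k) / 9:] \<tau> * c
      + rpoly [:1 / 9:] \<tau> * c ^ 2)"
    by (simp only:)
  have "[:of_int (1 + 6 * k) / 9:] = [:of_int (1 + 6 * k) / 9, 0, 0, 0 :: rat:]" by simp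
  from trace_integral[OF tr this] obtain z where "12 * (of_int (1 + 6 * k) / 9 :: rat) = of_int z" by blast
  then have "(of_int (4 * (1 + 6 * k)) :: rat) = of_int (3 * z)" by (simp add: field_simps)
  then have "4 * (1 + 6 * k) = 3 * z" by (simp only: of_int_eq_iff)
  then show False by presburger
qed

end

section \<open>Transfer to the generated field and ring\<close>

lemma int_adjoin_subset: "int_adjoin \<theta> \<subseteq> range (\<lambda>P. ipoly P \<theta>)"
proof
  let ?R = "ring_of_type_algebra :: complex ring"
  interpret R: ring ?R by (rule ring_from_type_algebra)
  have ops: "x \<oplus>\<^bsub>?R\<^esub> y = x + y" "x \<otimes>\<^bsub>?R\<^esub> y = x * y" "\<one>\<^bsub>?R\<^esub> = 1" "\<zero>\<^bsub>?R\<^esub> = 0" "x \<in> carrier ?R" for x y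
    by (simp_all add: ring_of_type_algebra_def)
  have neg: "\<ominus>\<^bsub>?R\<^esub> x = - x" for x
    using R.minus_equality[of "- x" x] by (simp add: ops)
  fix x assume "x \<in> int_adjoin \<theta>"
  then have "x \<in> generate_ring ?R {\<theta>}" by (simp add: int_adjoin_def)
  then show "x \<in> range (\<lambda>P. ipoly P \<theta>)"
  proof (induction rule: generate_ring.induct)
    case one
    then show ?case by (auto simp: ops intro!: range_eqI[of _ _ 1])
  next
    case (incl h)
    then show ?case by (auto intro!: range_eqI[of _ _ "[:0, 1:]"] simp: hom_distribs)
  next
    case (a_inv h)
    then obtain P where "h = ipoly P \<theta>" by auto
    then have "\<ominus>\<^bsub>?R\<^esub> h = ipoly (- P) \<theta>" by (simp add: neg)
    then show ?case by blast
  next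
    case (eng_add h1 h2)
    then obtain P Q where "h1 = ipoly P \<theta>" "h2 = ipoly Q \<theta>" by auto
    then have "h1 \<oplus>\<^bsub>?R\<^esub> h2 = ipoly (P + Q) \<theta>" by (simp add: ops)
    then show ?case by blast
  next
    case (eng_mult h1 h2)
    then obtain P Q where "h1 = ipoly P \<theta>" "h2 = ipoly Q \<theta>" by auto
    then have "h1 \<otimes>\<^bsub>?R\<^esub> h2 = ipoly (P * Q) \<theta>" by (simp add: ops)
    then show ?case by blast
  qed
qed

theorem theorem2p2:
  fixes m :: int and f :: "int Polynomial.poly" and \<alpha> :: complex and K :: "complex set"
  assumes "squarefree m" and "m \<noteq> 1" and "m \<noteq> -1"
    and "f = Polynomial.monom 1 12 - [:m:]"
    and "Polynomial.poly (map_poly of_int f) \<alpha> = 0"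
    and "K = rat_adjoin \<alpha>"
    and "[m = 1] (mod 4) \<or> [m = 1] (mod 9) \<or> [m = -1] (mod 9)"
  shows "\<not> monogenic K"
proof
  assume "monogenic K"
  then obtain \<theta> where theta: "\<theta> \<in> ring_of_integers K" "ring_of_integers K = int_adjoin \<theta>"
    unfolding monogenic_def by blast
  have root: "\<alpha> ^ 12 = of_int m" using assms(4,5) by (simp add: hom_distribs)
  interpret pure12 m \<alpha> by unfold_locales (use assms root in auto)
  have mono: "pure12_monogenic m \<alpha> e \<theta>" if e: "e = 1 \<or> e = - 1" for e
  proof -
    interpret T: pure12_tower m \<alpha> e "e * m" "of_int e * \<alpha> ^ 4" "\<alpha> ^ 3" "\<alpha> ^ 6"
      by unfold_locales (use e in auto)
    have A: "T.A = ring_of_integers (rat_adjoin \<alpha>)"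
      unfolding T.A_def T.K_def ring_of_integers_def rat_adjoin_eq ..
    have A: "T.A = int_adjoin \<theta>" unfolding A using theta assms(6) by simp
    show ?thesis
    proof unfold_locales
      show "\<theta> \<in> T.A" using theta A by simp
      show "\<exists>P. x = ipoly P \<theta>" if "x \<in> T.A" for x
        using that int_adjoin_subset[of \<theta>] unfolding A by blast
    qed
  qed
  have no_mod9: False if e: "e = 1 \<or> e = - 1" and k: "e * m = 9 * k + 1" for e k
  proof -
    interpret pure12_monogenic m \<alpha> e "e * m" "of_int e * \<alpha> ^ 4" "\<alpha> ^ 3" "\<alpha> ^ 6" \<theta>
      by (rule mono[OF e])
    interpret T: pure12_monogenic3 m \<alpha> e "e * m" "of_int e * \<alpha> ^ 4" "\<alpha> ^ 3" "\<alpha> ^ 6" k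
        "(1 + of_int e * \<alpha> ^ 4 + (of_int e * \<alpha> ^ 4) ^ 2) / 3" \<theta>
      by unfold_locales (use k in simp_all)
    show False using e T.not_monogenic_eps_1 T.not_monogenic_eps_minus_1 by blast
  qed
  have no_mod4: False if "m = 4 * l + 1" for l
  proof -
    interpret pure12_monogenic m \<alpha> 1 "1 * m" "of_int 1 * \<alpha> ^ 4" "\<alpha> ^ 3" "\<alpha> ^ 6" \<theta>
      by (rule mono) simp
    show False using not_1_mod_4 that by blast
  qed
  from assms(7) show False
  proof (elim disjE)
    assume "[m = 1] (mod 4)"
    then obtain l where "m - 1 = 4 * l" by (auto simp: cong_iff_dvd_diff)
    then show False using no_mod4[of l] by simp
  next
    assume "[m = 1] (mod 9)"
    then obtain k where "m - 1 = 9 * k" by (auto simp: cong_iff_dvd_diff)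
    then show False using no_mod9[of 1 k] by simp
  next
    assume "[m = - 1] (mod 9)"
    then obtain k where "m - - 1 = 9 * k" unfolding cong_iff_dvd_diff by (rule dvdE)
    \<comment> \<open>The sign turns \<open>m = 9 * k - 1\<close> into
      \<open>- m = 9 * (- k) + 1\<close>.\<close>
    then show False using no_mod9[of "- 1" "- k"] by simp
  qed
qed

end
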